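(* The self-similar solutions of the binormal flow $\chi_t=\chi_s\wedge\chi_{ss}$ are parametrized, up to rotations of $\mathbb{R}^3$, by a positive number $a$: they are the curves $\chi_a(s,t)=\sqrt t\,G_a(s/\sqrt t)$, $t>0$, $a>0$, described in the context. For every $a>0$ there are two unit vectors $A_a^+,A_a^-\in\mathbb{R}^3$, with $A_a^+\neq A_a^-$ and $A_a^+\neq -A_a^-$, such that for all $s\in\mathbb{R}$ and all $t\ge 0$ $$\left|\chi_a(s,t)-sA_a^+\,\mathbb{I}_{[0,\infty)}(s)-sA_a^-\,\mathbb{I}_{(-\infty,0]}(s)\right|\le 2a\sqrt t .$$ In particular, $\chi_a(s,0)=A_a^+s$ for $s>0$ and $\chi_a(s,0)=A_a^-s$ for $s<0$. Moreover, there exist $\tilde a>0$ and $\tilde{\tilde a}>0$ such that if $0<a<\tilde a$ then the curve $s\mapsto\chi_a(s,1)$ has no self-intersection, and if $a>\tilde{\tilde a}$ then the curve $s\mapsto\chi_a(s,1)$ has self-intersections, but only finitely many. Finally, if $\theta\in[0,\pi]$ denotes the angle between the vectors $A_a^+$ and $-A_a^-$, then $$\sin\frac{\theta}{2}=e^{-\frac{\pi a^2}{2}}.$$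
   Context: The binormal flow is the equation $\chi_t=\chi_s\wedge\chi_{ss}$ for curves $\chi(\cdot,t)$ in $\mathbb{R}^3$, where $s\in\mathbb{R}$ is the arclength parameter ($|\chi_s|=1$), $t$ is time and $\wedge$ is the cross product. A self-similar solution is a solution for $t>0$ of the form $\chi(s,t)=\sqrt t\,G(s/\sqrt t)$, with $G:\mathbb{R}\to\mathbb{R}^3$ smooth, $|G'|=1$, and nowhere vanishing curvature; equivalently $G$ satisfies $\frac12 G-\frac s2G'=G'\wedge G''$. For $a>0$, let $(T,n,b)$ be the solution on $\mathbb{R}$ of the Frenet system with curvature $a$ and torsion $s/2$, $$T'=a\,n,\qquad n'=-a\,T+\frac s2\,b,\qquad b'=-\frac s2\,n,$$ with $T(0)=(1,0,0)$, $n(0)=(0,1,0)$, $b(0)=(0,0,1)$, and let $G_a$ be given by $G_a'=T$, $G_a(0)=2a(0,0,1)$. Define $\chi_a(s,t)=\sqrt t\,G_a(s/\sqrt t)$ for $t>0$ (so $\chi_a(\cdot,t)$ has curvature $a/\sqrt t$ and torsion $s/(2t)$), and $\chi_a(s,0)=\lim_{t\to0^+}\chi_a(s,t)$. $\mathbb{I}_J$ denotes the characteristic function of the set $J$. A self-intersection of a curve $\gamma:\mathbb{R}\to\mathbb{R}^3$ is a pair $s_1\neq s_2$ with $\gamma(s_1)=\gamma(s_2)$. *)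

theory Defs
  imports "HOL-Analysis.Analysis"
begin

unbundle cross3_syntax

definition curve_deriv :: "(real \<Rightarrow> real^3) \<Rightarrow> real \<Rightarrow> real^3" where
  "curve_deriv \<gamma> s = vector_derivative \<gamma> (at s)"

definition smooth_curve :: "(real \<Rightarrow> real^3) \<Rightarrow> bool" where
  "smooth_curve \<gamma> \<longleftrightarrow> (\<forall>k s. (curve_deriv ^^ k) \<gamma> differentiable (at s))"

text \<open>The curvature of a curve that is parametrized by arclength.\<close>

definition curvature :: "(real \<Rightarrow> real^3) \<Rightarrow> real \<Rightarrow> real" where
  "curvature \<gamma> s = norm (curve_deriv (curve_deriv \<gamma>) s)"

text \<open>A curve evolution is a function of the arclength \<open>s\<close> and the time \<open>t\<close>, in this
  order. Since \<^const>\<open>vector_derivative\<close> is a total function, the existence of the derivatives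
  is required explicitly. Values at times \<open>t \<le> 0\<close> play no role.\<close>

definition solves_binormal_flow :: "(real \<Rightarrow> real \<Rightarrow> real^3) \<Rightarrow> bool" where
  "solves_binormal_flow X \<longleftrightarrow>
     (\<forall>t>0. \<forall>s. (let \<gamma> = (\<lambda>u. X u t) in
        \<gamma> differentiable (at s) \<and> norm (curve_deriv \<gamma> s) = 1 \<and>
        curve_deriv \<gamma> differentiable (at s) \<and>
        ((\<lambda>\<tau>. X s \<tau>) has_vector_derivative
           (curve_deriv \<gamma> s \<times> curve_deriv (curve_deriv \<gamma>) s)) (at t)))"

definition self_similar_solution :: "(real \<Rightarrow> real \<Rightarrow> real^3) \<Rightarrow> bool" where
  "self_similar_solution X \<longleftrightarrow>
     solves_binormal_flow X \<and>
     (\<exists>G. smooth_curve G \<and> (\<forall>s. norm (curve_deriv G s) = 1) \<and> (\<forall>s. curvature G s \<noteq> 0) \<and>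
          (\<forall>s. \<forall>t>0. X s t = sqrt t *\<^sub>R G (s / sqrt t)))"

definition frenet_frame ::
    "real \<Rightarrow> (real \<Rightarrow> real^3) \<Rightarrow> (real \<Rightarrow> real^3) \<Rightarrow> (real \<Rightarrow> real^3) \<Rightarrow> bool" where
  "frenet_frame a T n b \<longleftrightarrow>
     (\<forall>s. (T has_vector_derivative (a *\<^sub>R n s)) (at s)) \<and>
     (\<forall>s. (n has_vector_derivative (- a *\<^sub>R T s + (s / 2) *\<^sub>R b s)) (at s)) \<and>
     (\<forall>s. (b has_vector_derivative (- (s / 2) *\<^sub>R n s)) (at s)) \<and>
     T 0 = vector [1, 0, 0] \<and> n 0 = vector [0, 1, 0] \<and> b 0 = vector [0, 0, 1]"

text \<open>The description determines \<open>G\<close> uniquely: the frame is the solution of an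
  initial value problem for a linear system with continuous coefficients, which exists on the
  whole line and is unique.\<close>

definition profile :: "real \<Rightarrow> real \<Rightarrow> real^3" where
  "profile a = (THE G. \<exists>T n b. frenet_frame a T n b \<and>
       (\<forall>s. (G has_vector_derivative T s) (at s)) \<and> G 0 = (2 * a) *\<^sub>R vector [0, 0, 1])"

text \<open>The value for \<open>t < 0\<close> is irrelevant.\<close>

definition chi :: "real \<Rightarrow> real \<Rightarrow> real \<Rightarrow> real^3" where
  "chi a s t =
     (if t > 0 then sqrt t *\<^sub>R profile a (s / sqrt t)
      else Lim (at_right 0) (\<lambda>\<tau>. sqrt \<tau> *\<^sub>R profile a (s / sqrt \<tau>)))"

definition self_intersections :: "(real \<Rightarrow> real^3) \<Rightarrow> (real \<times> real) set" where
  "self_intersections \<gamma> = {(s1, s2). s1 \<noteq> s2 \<and> \<gamma> s1 = \<gamma> s2}"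

definition vec_angle :: "real^3 \<Rightarrow> real^3 \<Rightarrow> real" where
  "vec_angle u v = arccos ((u \<bullet> v) / (norm u * norm v))"

end

theory Submission
  imports Defs
begin

text \<open>Everything is read off from one linear system. A binormal flow solution of the form
\<open>\<surd>t G(s / \<surd>t)\<close> satisfies \<open>G' \<times> G'' = G/2 - s G'/2\<close>. The derivative of the right-hand side is
\<open>- s G''/2\<close>, which is orthogonal to the left-hand side; so the curvature \<open>a\<close> is constant, the
torsion is \<open>s/2\<close>, and \<open>G = s T + 2 a b\<close> for the Frenet frame \<open>(T, n, b)\<close>. As solutions of the
Frenet system with given initial values are unique, \<open>a\<close> and the frame at \<open>0\<close> determine \<open>G\<close>
(\<open>self_similar_imp_frame\<close>, \<open>self_similar_iff\<close>).

The identity \<open>G = s T + 2 a b\<close> also gives the geometry. It implies \<open>(G/s)' = - 2 a b / s\<^sup>2\<close>, so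
\<open>G/s\<close> converges at rate \<open>2a/s\<close> to a unit vector \<open>A\<close>, which is the bound \<open>2 a \<surd>t\<close> after scaling
(\<open>frenet_frame_asymptote\<close>). The Frenet system is invariant under \<open>s \<mapsto> - s\<close> combined with a
rotation by \<open>\<pi>\<close> about the first axis; therefore the other asymptotic direction is the image of
\<open>A\<close> under that rotation (\<open>profile_reflect\<close>), and the whole angle formula amounts to
\<open>A\<^sub>1 = exp (- \<pi> a\<^sup>2 / 2)\<close>. Moreover \<open>\<bar>G\<bar>\<^sup>2 = s\<^sup>2 + 4 a\<^sup>2\<close>, so that a self-intersection must
pair \<open>s\<close> with \<open>- s\<close>, and by the symmetry this happens exactly at the zeros of \<open>G\<^sub>1\<close>. These
zeros are bounded because \<open>A\<^sub>1 \<noteq> 0\<close>, and they do not accumulate because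
\<open>G\<^sub>1 = T\<^sub>1 = n\<^sub>1 = 0\<close> would force \<open>b\<^sub>1 = 0\<close> too. For small \<open>a\<close> the curve is close to a line and
\<open>G\<^sub>1 > 0\<close> on \<open>s > 0\<close>; for large \<open>a\<close> it makes several almost planar turns of radius about \<open>1/a\<close>
around \<open>s = 0\<close> before the torsion matters, and \<open>G\<^sub>1\<close> is negative after three quarters of a turn.

The value of \<open>A\<^sub>1\<close> is a formula of Landau-Zener type. Lifting the frame from rotations
to \<open>SU(2)\<close> turns the Frenet system into \<open>p' = - i a q / 2\<close>, \<open>q' = i s q / 2 - i a p / 2\<close>, whose
solution is an entire function of Kummer type, and \<open>T\<^sub>1 = \<bar>p\<bar>\<^sup>2 - \<bar>q\<bar>\<^sup>2 = 2 \<bar>p\<bar>\<^sup>2 - 1\<close>. At infinity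
\<open>p\<close> behaves like \<open>C exp (- i a\<^sup>2 ln s / 2)\<close> (\<open>spinor_asymptotics\<close>). To find \<open>\<bar>C\<bar>\<close>, consider the
integral over \<open>y > 0\<close> \<open>h(r) = \<integral> e\<^bsup>-y\<^esup> p(r \<surd>y) / \<surd>y dy\<close>. One integration by parts gives a
first-order equation for \<open>h\<close>, which yields \<open>\<bar>h(r)\<bar>\<^sup>2 = \<pi> exp (- a\<^sup>2 arctan (r\<^sup>2/4) / 2)\<close>
(\<open>spinor_transform_norm\<close>). As \<open>r\<close> tends to infinity, \<open>p\<close> may be replaced by its asymptotic form
and the integral becomes \<open>C \<Gamma>(1/2 - i a\<^sup>2/4)\<close> up to a phase. The reflection formula evaluates the
modulus of this Gamma value, and \<open>2 \<bar>C\<bar>\<^sup>2 = 1 + exp (- \<pi> a\<^sup>2 / 2)\<close> follows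
(\<open>spinor_amplitude\<close>).\<close>

section \<open>Frenet systems with linear torsion\<close>


text \<open>The system is linear with scalar coefficients, so that it makes sense in any normed space:
vector-valued solutions, their components and their linear images are handled together.\<close>

definition frenet_eqs ::
    "real \<Rightarrow> (real \<Rightarrow> 'v::real_normed_vector) \<Rightarrow> (real \<Rightarrow> 'v) \<Rightarrow> (real \<Rightarrow> 'v) \<Rightarrow> bool" where
  "frenet_eqs a T n b \<longleftrightarrow>
     (\<forall>s. (T has_vector_derivative (a *\<^sub>R n s)) (at s)) \<and>
     (\<forall>s. (n has_vector_derivative (- a *\<^sub>R T s + (s / 2) *\<^sub>R b s)) (at s)) \<and>
     (\<forall>s. (b has_vector_derivative (- (s / 2) *\<^sub>R n s)) (at s))"

lemma frenet_eqsD: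
  assumes "frenet_eqs a T n b"
  shows "(T has_vector_derivative (a *\<^sub>R n s)) (at s)"
    and "(n has_vector_derivative (- a *\<^sub>R T s + (s / 2) *\<^sub>R b s)) (at s)"
    and "(b has_vector_derivative (- (s / 2) *\<^sub>R n s)) (at s)"
  using assms unfolding frenet_eqs_def by blast+

lemma frenet_frame_iff:
  "frenet_frame a T n b \<longleftrightarrow> frenet_eqs a T n b \<and>
     T 0 = vector [1, 0, 0] \<and> n 0 = vector [0, 1, 0] \<and> b 0 = vector [0, 0, 1]"
  unfolding frenet_frame_def frenet_eqs_def by blast

lemma frenet_eqs_linear_image:
  assumes "bounded_linear L" "frenet_eqs a T n b"
  shows "frenet_eqs a (\<lambda>s. L (T s)) (\<lambda>s. L (n s)) (\<lambda>s. L (b s))"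
proof -
  interpret bounded_linear L by fact
  note d = frenet_eqsD[OF assms(2), THEN has_vector_derivative]
  show ?thesis
    unfolding frenet_eqs_def
    using d by (auto simp: scaleR add diff neg)
qed

lemma zero_derivative_imp_constant:
  fixes f :: "real \<Rightarrow> 'a::real_normed_vector"
  assumes "\<And>s. (f has_vector_derivative 0) (at s)"
  shows "f s = f r"
proof -
  obtain c where "\<And>x. x \<in> UNIV \<Longrightarrow> f x = c"
    by (rule has_vector_derivative_zero_constant[of UNIV f]) (use assms in auto)
  then show ?thesis by simp
qed

text \<open>The coefficient matrix of the system is skew-symmetric. For components of one frame this says that
the Gram matrix of the columns is conserved; for the difference of two solutions it gives
uniqueness.\<close>

lemma frenet_inner_constant:
  fixes T :: "real \<Rightarrow> 'v::real_inner"
  assumes "frenet_eqs a T n b" "frenet_eqs a T' n' b'"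
  shows "T s \<bullet> T' s + n s \<bullet> n' s + b s \<bullet> b' s = T 0 \<bullet> T' 0 + n 0 \<bullet> n' 0 + b 0 \<bullet> b' 0"
proof (rule zero_derivative_imp_constant[of "\<lambda>s. T s \<bullet> T' s + n s \<bullet> n' s + b s \<bullet> b' s"])
  fix s
  note d = frenet_eqsD[OF assms(1), of s] and d' = frenet_eqsD[OF assms(2), of s]
  note dd = bounded_bilinear.has_vector_derivative[OF bounded_bilinear_inner]
  show "((\<lambda>s. T s \<bullet> T' s + n s \<bullet> n' s + b s \<bullet> b' s) has_vector_derivative 0) (at s)"
    by (rule has_vector_derivative_eq_rhs[OF has_vector_derivative_add[OF
          has_vector_derivative_add[OF dd[OF d(1) d'(1)] dd[OF d(2) d'(2)]] dd[OF d(3) d'(3)]]])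
       (simp add: inner_simps algebra_simps inner_commute)
qed

lemma frenet_unique:
  fixes T :: "real \<Rightarrow> 'v::real_inner"
  assumes 1: "frenet_eqs a T n b" and 2: "frenet_eqs a T' n' b'"
    and "T 0 = T' 0" "n 0 = n' 0" "b 0 = b' 0"
  shows "T = T'" "n = n'" "b = b'"
proof -
  have e: "frenet_eqs a (\<lambda>s. T s - T' s) (\<lambda>s. n s - n' s) (\<lambda>s. b s - b' s)"
    unfolding frenet_eqs_def
    by (auto intro!: has_vector_derivative_eq_rhs[OF has_vector_derivative_diff]
          frenet_eqsD[OF 1] frenet_eqsD[OF 2] simp: algebra_simps)
  have *: "(norm (T s - T' s))\<^sup>2 + (norm (n s - n' s))\<^sup>2 + (norm (b s - b' s))\<^sup>2 = 0" for s
    using frenet_inner_constant[OF e e, of s] assms(3-5) by (simp add: power2_norm_eq_inner)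
  have "T s = T' s \<and> n s = n' s \<and> b s = b' s" for s
  proof -
    have "(norm (T s - T' s))\<^sup>2 = 0" "(norm (n s - n' s))\<^sup>2 = 0" "(norm (b s - b' s))\<^sup>2 = 0"
      using *[of s] zero_le_power2[of "norm (T s - T' s)"] zero_le_power2[of "norm (n s - n' s)"]
        zero_le_power2[of "norm (b s - b' s)"] by linarith+
    then show ?thesis by simp
  qed
  then show "T = T'" "n = n'" "b = b'" by auto
qed

lemma frenet_frame_components:
  assumes "frenet_frame a T n b"
  shows "frenet_eqs a (\<lambda>s. T s $ i) (\<lambda>s. n s $ i) (\<lambda>s. b s $ i)"
  using assms frenet_eqs_linear_image[OF bounded_linear_vec_nth] frenet_frame_iff by blast

text \<open>Conservation yields orthonormal columns of the matrix with rows \<open>T, n, b\<close>; a square matrix with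
orthonormal columns has orthonormal rows.\<close>

lemma frenet_frame_orthonormal:
  assumes "frenet_frame a T n b"
  shows "T s \<bullet> T s = 1" "n s \<bullet> n s = 1" "b s \<bullet> b s = 1" "T s \<bullet> n s = 0" "T s \<bullet> b s = 0" "n s \<bullet> b s = 0"
    and "T s $ i * T s $ j + n s $ i * n s $ j + b s $ i * b s $ j = (if i = j then 1 else 0)"
proof -
  show c: "T s $ i * T s $ j + n s $ i * n s $ j + b s $ i * b s $ j = (if i = j then 1 else 0)" for i j
    using frenet_inner_constant[OF frenet_frame_components[OF assms, of i]
        frenet_frame_components[OF assms, of j], of s]
      assms exhaust_3[of i] exhaust_3[of j]
    by (auto simp: frenet_frame_def)
  define F :: "real^3^3" where "F = vector [T s, n s, b s]"
  have "transpose F ** F = mat 1"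
    using c by (simp add: vec_eq_iff matrix_matrix_mult_def transpose_def F_def mat_def sum_3)
  then have "F ** transpose F = mat 1"
    using matrix_left_right_inverse by blast
  then have "\<And>i j. (F ** transpose F) $ i $ j = mat 1 $ i $ j" by simp
  then have "\<And>i j. F $ i \<bullet> F $ j = (if i = j then 1 else 0)"
    by (simp add: matrix_matrix_mult_def transpose_def inner_vec_def mat_def)
  from this[of 1 1] this[of 2 2] this[of 3 3] this[of 1 2] this[of 1 3] this[of 2 3]
  show "T s \<bullet> T s = 1" "n s \<bullet> n s = 1" "b s \<bullet> b s = 1" "T s \<bullet> n s = 0" "T s \<bullet> b s = 0" "n s \<bullet> b s = 0"
    by (simp_all add: F_def)
qed

lemma cross_has_vector_derivative:
  assumes "(f has_vector_derivative f') (at s)" "(g has_vector_derivative g') (at s)"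
  shows "((\<lambda>s. f s \<times> g s) has_vector_derivative (f s \<times> g' + f' \<times> g s)) (at s)"
  by (rule bounded_bilinear.has_vector_derivative[OF _ assms])
     (simp add: bilinear_conv_bounded_bilinear[symmetric] bilinear_cross)

text \<open>The triple product of the frame has derivative zero, hence stays \<open>1\<close>. With orthonormality this
determines the orientation: \<open>T \<times> n\<close> and \<open>b\<close> are unit vectors with inner product \<open>1\<close>.\<close>

lemma frenet_frame_cross:
  assumes "frenet_frame a T n b"
  shows "T s \<times> n s = b s"
proof -
  note e = frenet_eqsD[OF conjunct1[OF assms[unfolded frenet_frame_iff]]]
  note o = frenet_frame_orthonormal[OF assms]
  have "((\<lambda>s. (T s \<times> n s) \<bullet> b s) has_vector_derivative 0) (at s)" for s
    by (rule has_vector_derivative_eq_rhs[OF bounded_bilinear.has_vector_derivative[OF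
          bounded_bilinear_inner cross_has_vector_derivative[OF e(1,2)] e(3)]])
       (simp add: cross_add_left cross_add_right cross_mult_left cross_mult_right inner_simps
         dot_cross_self Cross3.right_diff_distrib)
  from zero_derivative_imp_constant[of "\<lambda>s. (T s \<times> n s) \<bullet> b s", OF this, of s 0]
  have triple: "(T s \<times> n s) \<bullet> b s = 1"
    using assms by (simp add: frenet_frame_def cross3_def inner_vec_def sum_3)
  have "(norm (T s \<times> n s))\<^sup>2 = 1"
    using o norm_cross[of "T s" "n s"] by (simp add: power2_norm_eq_inner)
  then have "(T s \<times> n s - b s) \<bullet> (T s \<times> n s - b s) = 0"
    using triple o(3) by (simp add: power2_norm_eq_inner inner_simps inner_commute)
  then show ?thesis by simp
qed

section \<open>The spinor form of the Frenet system\<close>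


text \<open>The coefficients of Kummer's function \<open>M(i \<mu>, 1/2, i z/4)\<close>, written as a power series in \<open>z\<close>;
it is evaluated at \<open>z = s\<^sup>2\<close> and \<open>\<mu> = a\<^sup>2/4\<close> below.\<close>

primrec kummer_coeff :: "real \<Rightarrow> nat \<Rightarrow> complex" where
  "kummer_coeff \<mu> 0 = 1"
| "kummer_coeff \<mu> (Suc k) = (\<i> * of_nat k - of_real \<mu>) / of_nat ((2 * k + 2) * (2 * k + 1)) * kummer_coeff \<mu> k"

lemma summable_kummer_coeff:
  assumes "\<mu> \<ge> 0"
  shows "summable (\<lambda>k. kummer_coeff \<mu> k * z ^ k)"
proof -
  obtain N :: nat where N: "(1 + \<mu>) * norm z \<le> real N"
    using real_arch_simple by blast
  have "norm (kummer_coeff \<mu> (Suc k) * z ^ Suc k) \<le> 1/2 * norm (kummer_coeff \<mu> k * z ^ k)" if k: "k \<ge> N" for k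
  proof -
    have "norm (\<i> * of_nat k - complex_of_real \<mu>) \<le> real k + \<mu>"
      using norm_triangle_ineq4[of "\<i> * of_nat k" "complex_of_real \<mu>"] assms by (simp add: norm_mult)
    also have "\<dots> \<le> (1 + \<mu>) * (real k + 1)"
      using assms by (simp add: algebra_simps)
    finally have "norm (\<i> * of_nat k - complex_of_real \<mu>) * norm z \<le> (1 + \<mu>) * (real k + 1) * norm z"
      by (simp add: mult_right_mono)
    also have "\<dots> = (real k + 1) * ((1 + \<mu>) * norm z)" by simp
    also have "\<dots> \<le> (real k + 1) * real k"
      using N k by (intro mult_left_mono) auto
    also have "\<dots> \<le> 1 / 2 * real ((2 * k + 2) * (2 * k + 1))"
      by (simp add: algebra_simps)
    finally have "norm (\<i> * of_nat k - complex_of_real \<mu>) * norm z / real ((2 * k + 2) * (2 * k + 1)) \<le> 1 / 2"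
      by (subst pos_divide_le_eq) (simp_all del: of_nat_mult)
    then have "norm (\<i> * of_nat k - complex_of_real \<mu>) * norm z / real ((2 * k + 2) * (2 * k + 1))
        * norm (kummer_coeff \<mu> k * z ^ k) \<le> 1 / 2 * norm (kummer_coeff \<mu> k * z ^ k)"
      by (rule mult_right_mono) simp
    then show ?thesis
      unfolding kummer_coeff.simps norm_mult norm_divide norm_of_nat power_Suc
      by (simp only: mult_ac times_divide_eq_left times_divide_eq_right)
  qed
  then show ?thesis by (intro summable_ratio_test[of "1/2" N]) auto
qed

text \<open>The two-term recursion for the coefficients is the differential equation read coefficientwise.\<close>

lemma kummer_equation:
  assumes "\<mu> \<ge> 0"
  obtains F F' F'' :: "complex \<Rightarrow> complex" where
    "\<And>z. (F has_field_derivative F' z) (at z)" "\<And>z. (F' has_field_derivative F'' z) (at z)"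
    "\<And>z. 4 * z * F'' z + 2 * F' z = \<i> * z * F' z - of_real \<mu> * F z" "F 0 = 1"
proof -
  define c where "c = kummer_coeff \<mu>"
  have s0: "summable (\<lambda>n. c n * z ^ n)" for z
    unfolding c_def by (rule summable_kummer_coeff[OF assms])
  have s1: "summable (\<lambda>n. diffs c n * z ^ n)" for z
    by (rule termdiff_converges_all[OF s0])
  have s2: "summable (\<lambda>n. diffs (diffs c) n * z ^ n)" for z
    by (rule termdiff_converges_all[OF s1])
  define F F' F'' where "F = (\<lambda>z. \<Sum>n. c n * z ^ n)" and "F' = (\<lambda>z. \<Sum>n. diffs c n * z ^ n)"
    and "F'' = (\<lambda>z. \<Sum>n. diffs (diffs c) n * z ^ n)"
  have index: "(\<lambda>n. of_nat n * d n * z ^ n) sums (z * (\<Sum>n. diffs d n * z ^ n))"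
    if "summable (\<lambda>n. diffs d n * z ^ n)" for d and z :: complex
  proof -
    have e: "z * (of_nat n * d n * z ^ (n - Suc 0)) = of_nat n * d n * z ^ n" for n
      by (cases n) (simp_all add: mult_ac)
    show ?thesis using sums_mult[OF diffs_equiv[OF that], of z] by (simp only: e)
  qed
  have ode: "4 * z * F'' z + 2 * F' z = \<i> * z * F' z - of_real \<mu> * F z" for z
  proof -
    have "(\<lambda>n. 4 * (of_nat n * diffs c n * z ^ n) + 2 * (diffs c n * z ^ n))
        sums (4 * (z * F'' z) + 2 * F' z)"
      unfolding F'_def F''_def
      by (intro sums_add sums_mult index[OF s2] summable_sums[OF s1])
    moreover have "(\<lambda>n. \<i> * (of_nat n * c n * z ^ n) - of_real \<mu> * (c n * z ^ n))
        sums (\<i> * (z * F' z) - of_real \<mu> * F z)"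
      unfolding F_def F'_def
      by (intro sums_diff sums_mult index[OF s1] summable_sums[OF s0])
    moreover have "4 * (of_nat n * diffs c n * z ^ n) + 2 * (diffs c n * z ^ n)
        = \<i> * (of_nat n * c n * z ^ n) - of_real \<mu> * (c n * z ^ n)" for n
    proof -
      have nz: "of_nat ((2 * n + 2) * (2 * n + 1)) \<noteq> (0::complex)"
        by (simp only: of_nat_eq_0_iff) simp
      have "(4 * of_nat n + 2) * diffs c n = of_nat ((2 * n + 2) * (2 * n + 1)) * c (Suc n)"
        unfolding diffs_def by (simp add: algebra_simps)
      also have "\<dots> = (\<i> * of_nat n - of_real \<mu>) * c n"
        unfolding c_def kummer_coeff.simps using nz by (simp del: of_nat_mult of_nat_add)
      finally have "(4 * of_nat n + 2) * diffs c n * z ^ n = (\<i> * of_nat n - of_real \<mu>) * c n * z ^ n"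
        by simp
      then show ?thesis by (simp add: algebra_simps)
    qed
    ultimately show ?thesis
      by (simp add: sums_iff mult.assoc)
  qed
  show thesis
  proof (rule that[of F F' F''])
    show "(F has_field_derivative F' z) (at z)" for z
      unfolding F_def F'_def by (rule termdiffs_strong_converges_everywhere[OF s0])
    show "(F' has_field_derivative F'' z) (at z)" for z
      unfolding F'_def F''_def by (rule termdiffs_strong_converges_everywhere[OF s1])
    show "F 0 = 1" by (simp add: F_def c_def)
  qed (rule ode)
qed

text \<open>The frame lifted to \<open>SU(2)\<close>, in a gauge that makes the first equation free of \<open>s\<close>. Eliminating
\<open>q\<close> gives \<open>p'' = (i s / 2) p' - (a\<^sup>2/4) p\<close>.\<close>

definition spinor :: "real \<Rightarrow> (real \<Rightarrow> complex) \<Rightarrow> (real \<Rightarrow> complex) \<Rightarrow> bool" where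
  "spinor a p q \<longleftrightarrow>
     (\<forall>s. (p has_vector_derivative - (\<i> * a / 2 * q s)) (at s)) \<and>
     (\<forall>s. (q has_vector_derivative \<i> * s / 2 * q s - \<i> * a / 2 * p s) (at s)) \<and>
     p 0 = 1 \<and> q 0 = 0"

lemma spinorD:
  assumes "spinor a p q"
  shows "(p has_vector_derivative - (\<i> * a / 2 * q s)) (at s)"
    and "(q has_vector_derivative \<i> * s / 2 * q s - \<i> * a / 2 * p s) (at s)"
    and "p 0 = 1" "q 0 = 0"
  using assms unfolding spinor_def by blast+

text \<open>With \<open>F\<close> from the Kummer equation, \<open>p(s) = F(s\<^sup>2)\<close> is the even solution of the second-order
equation, and \<open>q\<close> is defined by the first of the two equations.\<close>

lemma spinor_exists:
  assumes "a > 0"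
  obtains p q where "spinor a p q"
proof -
  obtain F F' F'' :: "complex \<Rightarrow> complex" where F:
    "\<And>z. (F has_field_derivative F' z) (at z)" "\<And>z. (F' has_field_derivative F'' z) (at z)"
    "\<And>z. 4 * z * F'' z + 2 * F' z = \<i> * z * F' z - of_real (a\<^sup>2 / 4) * F z" "F 0 = 1"
    using kummer_equation[of "a\<^sup>2 / 4"] by auto
  define P where "P = (\<lambda>s::complex. F (s\<^sup>2))"
  define Q where "Q = (\<lambda>s::complex. 4 * \<i> / a * (s * F' (s\<^sup>2)))"
  have sq: "((\<lambda>s. s\<^sup>2) has_field_derivative 2 * s) (at s)" for s :: complex
    by (auto intro!: derivative_eq_intros)
  have P: "(P has_field_derivative - (\<i> * a / 2 * Q s)) (at s)" for s
    unfolding P_def Q_def using assms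
    by (auto intro!: DERIV_cong[OF DERIV_chain2[OF F(1) sq]] simp: field_simps)
  have "(Q has_field_derivative 4 * \<i> / a * (F' (s\<^sup>2) + s * (F'' (s\<^sup>2) * (2 * s)))) (at s)" for s
    unfolding Q_def
    by (intro DERIV_cmult) (auto intro!: DERIV_cong[OF DERIV_mult[OF DERIV_ident DERIV_chain2[OF F(2) sq]]])
  moreover have "4 * \<i> / a * (F' (s\<^sup>2) + s * (F'' (s\<^sup>2) * (2 * s))) = \<i> * s / 2 * Q s - \<i> * a / 2 * P s" for s
  proof -
    have "F' (s\<^sup>2) + s * (F'' (s\<^sup>2) * (2 * s)) = (4 * s\<^sup>2 * F'' (s\<^sup>2) + 2 * F' (s\<^sup>2)) / 2"
      by (simp add: power2_eq_square field_simps)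
    also have "\<dots> = (\<i> * s\<^sup>2 * F' (s\<^sup>2) - of_real (a\<^sup>2 / 4) * F (s\<^sup>2)) / 2"
      unfolding F(3) ..
    finally have *: "F' (s\<^sup>2) + s * (F'' (s\<^sup>2) * (2 * s)) = \<dots>" .
    show ?thesis
      unfolding * P_def Q_def using assms by (simp add: field_simps power2_eq_square)
  qed
  ultimately have Q: "(Q has_field_derivative \<i> * s / 2 * Q s - \<i> * a / 2 * P s) (at s)" for s
    by simp
  have "spinor a (\<lambda>s. P (of_real s)) (\<lambda>s. Q (of_real s))"
    unfolding spinor_def
    using has_vector_derivative_real_field[OF P] has_vector_derivative_real_field[OF Q]
    by (auto simp: P_def Q_def F(4))
  then show thesis by (rule that)
qed

lemma has_vector_derivative_Re: "(f has_vector_derivative f') F \<Longrightarrow> ((\<lambda>s. Re (f s)) has_vector_derivative Re f') F"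
  by (rule bounded_linear.has_vector_derivative[OF bounded_linear_Re])

lemma has_vector_derivative_Im: "(f has_vector_derivative f') F \<Longrightarrow> ((\<lambda>s. Im (f s)) has_vector_derivative Im f') F"
  by (rule bounded_linear.has_vector_derivative[OF bounded_linear_Im])

text \<open>The Hopf map: if \<open>z\<close> is the product of \<open>q\<close> with the conjugate of \<open>p\<close>, the first coordinates of
the frame are \<open>\<bar>p\<bar>\<^sup>2 - \<bar>q\<bar>\<^sup>2\<close>, \<open>2 Im z\<close> and \<open>2 Re z\<close>. A common phase of \<open>p\<close> and \<open>q\<close> cancels in
them.\<close>

lemma spinor_first_component:
  assumes "spinor a p q"
  shows "frenet_eqs a (\<lambda>s. Re (cnj (p s) * p s - cnj (q s) * q s))
    (\<lambda>s. 2 * Im (cnj (p s) * q s)) (\<lambda>s. 2 * Re (cnj (p s) * q s))"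
proof -
  note d = spinorD(1,2)[OF assms]
  note dc = d[THEN has_vector_derivative_cnj]
  note m = has_vector_derivative_mult
  show ?thesis
    unfolding frenet_eqs_def
    apply (intro conjI allI)
      apply (rule has_vector_derivative_eq_rhs[OF has_vector_derivative_Re[OF has_vector_derivative_diff[OF m[OF dc(1) d(1)] m[OF dc(2) d(2)]]]])
      apply (simp add: algebra_simps)
     apply (rule has_vector_derivative_eq_rhs[OF has_vector_derivative_mult[OF has_vector_derivative_const
       has_vector_derivative_Im[OF m[OF dc(1) d(2)]]]])
     apply (simp add: field_simps)
     apply (rule has_vector_derivative_eq_rhs[OF has_vector_derivative_mult[OF has_vector_derivative_const
       has_vector_derivative_Re[OF m[OF dc(1) d(2)]]]])
    apply (simp add: field_simps)
    done
qed

text \<open>The remaining two columns are the real and imaginary parts of quadratic expressions in \<open>(p, q)\<close>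
without conjugation. Here the gauge phase does not cancel, which explains the factor
\<open>exp (- i s\<^sup>2 / 4)\<close>.\<close>

lemma spinor_other_components:
  assumes "spinor a p q"
  defines "e \<equiv> \<lambda>s. exp (- (\<i> * (of_real s)\<^sup>2 / 4))"
  shows "frenet_eqs a (\<lambda>s. e s * (2 * \<i> * (p s * q s)))
    (\<lambda>s. e s * (p s * p s + q s * q s)) (\<lambda>s. e s * (\<i> * (q s * q s - p s * p s)))"
proof -
  have "((\<lambda>z. exp (- (\<i> * z\<^sup>2 / 4))) has_field_derivative - (\<i> * z / 2) * exp (- (\<i> * z\<^sup>2 / 4))) (at z)" for z
    by (auto intro!: derivative_eq_intros)
  then have e: "(e has_vector_derivative - (\<i> * of_real s / 2) * e s) (at s)" for s
    unfolding e_def by (rule has_vector_derivative_real_field)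
  note d = spinorD(1,2)[OF assms(1)]
  note m = has_vector_derivative_mult
  show ?thesis
    unfolding frenet_eqs_def
    apply (intro conjI allI)
      apply (rule has_vector_derivative_eq_rhs[OF m[OF e m[OF has_vector_derivative_const m[OF d]]]])
      apply (simp add: field_simps scaleR_conv_of_real)
      apply (rule has_vector_derivative_eq_rhs[OF m[OF e has_vector_derivative_add[OF m[OF d(1) d(1)] m[OF d(2) d(2)]]]])
      apply (simp add: field_simps scaleR_conv_of_real)
      apply (rule has_vector_derivative_eq_rhs[OF m[OF e m[OF has_vector_derivative_const has_vector_derivative_diff[OF m[OF d(2) d(2)] m[OF d(1) d(1)]]]]])
      apply (simp add: field_simps scaleR_conv_of_real)
    done
qed

lemma frenet_eqs_combine:
  assumes "frenet_eqs a T1 n1 b1" "frenet_eqs a T2 n2 b2" "frenet_eqs a T3 n3 b3"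
  shows "frenet_eqs a (\<lambda>s. vector [T1 s, T2 s, T3 s] :: real^3)
     (\<lambda>s. vector [n1 s, n2 s, n3 s]) (\<lambda>s. vector [b1 s, b2 s, b3 s])"
proof -
  have v: "vector [x, y, z] = x *\<^sub>R axis 1 1 + y *\<^sub>R axis 2 1 + z *\<^sub>R (axis 3 1 :: real^3)" for x y z
    by (simp add: vec_eq_iff forall_3 axis_def)
  have d: "((\<lambda>s. vector [f s, g s, h s] :: real^3) has_vector_derivative w) (at s)"
    if "(f has_vector_derivative f') (at s)" "(g has_vector_derivative g') (at s)"
      "(h has_vector_derivative h') (at s)" "w = vector [f', g', h']" for f g h f' g' h' s w
    unfolding v that(4)
    by (intro has_vector_derivative_add bounded_linear.has_vector_derivative[OF bounded_linear_scaleR_left] that)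
  show ?thesis
    unfolding frenet_eqs_def
    by (intro conjI allI; rule d, (rule frenet_eqsD[OF assms(1)] frenet_eqsD[OF assms(2)] frenet_eqsD[OF assms(3)])+)
       (simp_all add: vec_eq_iff forall_3)
qed

text \<open>The initial value of the third quadratic expression is \<open>- i\<close> where the frame has \<open>b(0) = (0,0,1)\<close>.
So the second coordinates are the real parts and the third coordinates the negated imaginary
parts.\<close>

lemma frenet_frame_exists:
  assumes "a > 0"
  obtains T n b where "frenet_frame a T n b"
proof -
  obtain p q where pq: "spinor a p q"
    using spinor_exists[OF assms] by blast
  note o = spinor_other_components[OF pq]
  have "\<exists>T n b. frenet_frame a T n b"
    unfolding frenet_frame_iff
    by (intro exI conjI, rule frenet_eqs_combine[OF spinor_first_component[OF pq]
        frenet_eqs_linear_image[OF bounded_linear_Re o]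
        frenet_eqs_linear_image[OF bounded_linear_compose[OF bounded_linear_Im bounded_linear_cnj] o]])
       (simp_all add: spinorD(3,4)[OF pq])
  then show thesis using that by blast
qed

lemma spinor_norm:
  assumes "spinor a p q"
  shows "(norm (p s))\<^sup>2 + (norm (q s))\<^sup>2 = 1"
proof -
  note d = spinorD(1,2)[OF assms]
  note dc = d[THEN has_vector_derivative_cnj]
  note m = has_vector_derivative_mult
  have "((\<lambda>s. Re (cnj (p s) * p s + cnj (q s) * q s)) has_vector_derivative 0) (at s)" for s
    by (rule has_vector_derivative_eq_rhs[OF has_vector_derivative_Re[OF has_vector_derivative_add[OF
          m[OF dc(1) d(1)] m[OF dc(2) d(2)]]]])
       (simp add: algebra_simps)
  from zero_derivative_imp_constant[OF this, of s 0] show ?thesis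
    unfolding cmod_power2 using spinorD(3,4)[OF assms] by (simp add: power2_eq_square)
qed

lemma spinor_le_one:
  assumes "spinor a p q"
  shows "norm (p s) \<le> 1" "norm (q s) \<le> 1"
  using spinor_norm[OF assms, of s] abs_le_square_iff[of "norm (q s)" 1] abs_le_square_iff[of "norm (p s)" 1]
    zero_le_power2[of "norm (p s)"] zero_le_power2[of "norm (q s)"] by simp_all

lemma spinor_continuous:
  assumes "spinor a p q"
  shows "continuous_on UNIV p" "continuous_on UNIV q"
  using spinorD(1,2)[OF assms]
  by (auto intro!: continuous_at_imp_continuous_on has_vector_derivative_continuous)

lemma spinor_tangent:
  assumes "spinor a p q" "frenet_frame a T n b"
  shows "T s $ 1 = (norm (p s))\<^sup>2 - (norm (q s))\<^sup>2"
proof -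
  have "(\<lambda>s. T s $ 1) = (\<lambda>s. Re (cnj (p s) * p s - cnj (q s) * q s))"
    by (rule frenet_unique(1)[OF frenet_frame_components[OF assms(2), of 1] spinor_first_component[OF assms(1)]])
       (use assms(2) spinorD(3,4)[OF assms(1)] in \<open>simp_all add: frenet_frame_def\<close>)
  from fun_cong[OF this, of s] show ?thesis
    unfolding cmod_power2 by (simp add: power2_eq_square)
qed

section \<open>The profile and its asymptotic cone\<close>


text \<open>Uniqueness of the frame makes the definite description in the definition of the profile
well-defined, so any candidate that satisfies the description is the profile.\<close>

lemma profile_eqI:
  assumes "frenet_frame a T n b" "\<And>s. (G has_vector_derivative T s) (at s)"
    "G 0 = (2 * a) *\<^sub>R vector [0, 0, 1]"
  shows "profile a = G"
  unfolding profile_def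
proof (rule the_equality)
  show "\<exists>T n b. frenet_frame a T n b \<and> (\<forall>s. (G has_vector_derivative T s) (at s)) \<and>
      G 0 = (2 * a) *\<^sub>R vector [0, 0, 1]"
    using assms by blast
next
  fix G' assume "\<exists>T n b. frenet_frame a T n b \<and> (\<forall>s. (G' has_vector_derivative T s) (at s)) \<and>
      G' 0 = (2 * a) *\<^sub>R vector [0, 0, 1]"
  then obtain T' n' b' where G': "frenet_frame a T' n' b'"
    "\<And>s. (G' has_vector_derivative T' s) (at s)" "G' 0 = (2 * a) *\<^sub>R vector [0, 0, 1]"
    by blast
  have "T' = T"
    using assms(1) G'(1) unfolding frenet_frame_iff by (intro frenet_unique(1)[of a T' n' b' T n b]) auto
  then have "((\<lambda>s. G' s - G s) has_vector_derivative 0) (at s)" for s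
    using has_vector_derivative_diff[OF G'(2) assms(2), of s] by simp
  from zero_derivative_imp_constant[OF this, of _ 0] show "G' = G"
    using G'(3) assms(3) by auto
qed

text \<open>In \<open>(s T + 2 a b)' = T + s a n - 2 a (s/2) n\<close> the normal terms cancel.\<close>

lemma
  assumes "frenet_frame a T n b"
  shows profile_eq_frame: "profile a s = s *\<^sub>R T s + (2 * a) *\<^sub>R b s"
    and profile_has_derivative: "(profile a has_vector_derivative T s) (at s)"
proof -
  note d = frenet_eqsD[OF conjunct1[OF assms[unfolded frenet_frame_iff]]]
  have *: "((\<lambda>s. s *\<^sub>R T s + (2 * a) *\<^sub>R b s) has_vector_derivative T s) (at s)" for s
    by (rule has_vector_derivative_eq_rhs[OF has_vector_derivative_add[OF
          bounded_bilinear.has_vector_derivative[OF bounded_bilinear_scaleR has_vector_derivative_id d(1)]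
          bounded_linear.has_vector_derivative[OF bounded_linear_scaleR_right d(3)]]])
      (simp add: algebra_simps)
  have e: "profile a = (\<lambda>s. s *\<^sub>R T s + (2 * a) *\<^sub>R b s)"
    using assms by (intro profile_eqI[OF assms *]) (simp add: frenet_frame_def)
  show "profile a s = s *\<^sub>R T s + (2 * a) *\<^sub>R b s"
    by (simp add: e)
  show "(profile a has_vector_derivative T s) (at s)"
    using * by (simp add: e)
qed

lemma norm_diff_le_of_derivative_le:
  fixes f :: "real \<Rightarrow> 'a::real_normed_vector" and \<phi> :: "real \<Rightarrow> real"
  assumes "r \<le> s"
    and "\<And>x. r \<le> x \<Longrightarrow> x \<le> s \<Longrightarrow> (f has_vector_derivative f' x) (at x)"
    and "\<And>x. r \<le> x \<Longrightarrow> x \<le> s \<Longrightarrow> (\<phi> has_vector_derivative \<phi>' x) (at x)"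
    and "\<And>x. r \<le> x \<Longrightarrow> x \<le> s \<Longrightarrow> norm (f' x) \<le> \<phi>' x"
  shows "norm (f s - f r) \<le> \<phi> s - \<phi> r"
proof (cases "r = s")
  case False
  show ?thesis
  proof (rule differentiable_bound_general[where f' = f' and \<phi>' = \<phi>'])
    show "r < s" using False assms(1) by simp
    show "continuous_on {r..s} f" "continuous_on {r..s} \<phi>"
      using assms(2,3) by (auto intro!: continuous_at_imp_continuous_on has_vector_derivative_continuous)
  qed (use assms(2-4) in auto)
qed simp

text \<open>Comparison with \<open>- K / x\<close>, whose derivative is \<open>K / x\<^sup>2\<close>. This gives both the Cauchy criterion
and the rate of convergence.\<close>

lemma limit_at_top_if_derivative_inverse_square:
  fixes f :: "real \<Rightarrow> 'a::banach"
  assumes d: "\<And>x. x > 0 \<Longrightarrow> (f has_vector_derivative f' x) (at x)"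
    and bd: "\<And>x. x > 0 \<Longrightarrow> norm (f' x) \<le> K / x\<^sup>2" and "K \<ge> 0"
  obtains L where "\<And>s. s > 0 \<Longrightarrow> norm (f s - L) \<le> K / s"
proof -
  have step: "norm (f r - f s) \<le> K / s" if "0 < s" "s \<le> r" for s r
  proof -
    have "norm (f r - f s) \<le> (- K / r) - (- K / s)"
    proof (rule norm_diff_le_of_derivative_le[where f' = f' and \<phi>' = "\<lambda>x. K / x\<^sup>2", OF that(2)])
      fix x assume "s \<le> x" "x \<le> r"
      then have x: "x > 0" using that by simp
      show "(f has_vector_derivative f' x) (at x)" "norm (f' x) \<le> K / x\<^sup>2"
        using d bd x by auto
      show "((\<lambda>x. - K / x) has_vector_derivative K / x\<^sup>2) (at x)"
        using x by (auto intro!: derivative_eq_intros simp: power2_eq_square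
            simp flip: has_real_derivative_iff_has_vector_derivative)
    qed
    moreover have "K / r \<ge> 0" using that assms(3) by simp
    ultimately show ?thesis by simp
  qed
  define S where "S = (\<lambda>k. f (real (Suc k)))"
  have lim0: "(\<lambda>k. K / real (Suc k)) \<longlonglongrightarrow> 0"
    using LIMSEQ_inverse_real_of_nat[THEN tendsto_mult_right_zero, of K]
    by (simp add: divide_inverse)
  have "Cauchy S"
  proof (rule metric_CauchyI)
    fix e :: real assume "e > 0"
    then obtain N where N: "K / real (Suc N) < e / 2"
      using order_tendstoD(2)[OF lim0, of "e / 2"] by (auto simp: eventually_sequentially)
    have S: "norm (S m - S N) \<le> K / real (Suc N)" if "N \<le> m" for m
      unfolding S_def by (rule step) (use that in auto)
    have "norm ((S m - S N) - (S k - S N)) < e" if "N \<le> m" "N \<le> k" for m k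
      using S[OF that(1)] S[OF that(2)] N norm_triangle_ineq4[of "S m - S N" "S k - S N"] by linarith
    then have "norm (S m - S k) < e" if "N \<le> m" "N \<le> k" for m k
      using that by simp
    then show "\<exists>M. \<forall>m\<ge>M. \<forall>k\<ge>M. dist (S m) (S k) < e" by (auto simp: dist_norm)
  qed
  then obtain L where L: "S \<longlonglongrightarrow> L"
    using Cauchy_convergent_iff convergent_def by blast
  have "norm (f s - L) \<le> K / s" if "s > 0" for s
  proof (rule Lim_norm_ubound[OF sequentially_bot])
    show "(\<lambda>k. f s - S k) \<longlonglongrightarrow> f s - L"
      by (intro tendsto_intros L)
    obtain N :: nat where "s \<le> real N" using real_arch_simple by blast
    then have "norm (f s - S k) \<le> K / s" if "k \<ge> N" for k
      using step[OF \<open>s > 0\<close>, of "real (Suc k)"] that by (simp add: S_def norm_minus_commute)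
    then show "\<forall>\<^sub>F k in sequentially. norm (f s - S k) \<le> K / s"
      by (auto simp: eventually_sequentially)
  qed
  then show thesis by (rule that)
qed

text \<open>The derivative of \<open>G/s\<close> is \<open>- 2 a b / s\<^sup>2\<close> with \<open>\<bar>b\<bar> = 1\<close>. Multiplying the resulting estimate by
\<open>s\<close> keeps the sharp constant \<open>2 a\<close>, and \<open>T = G/s - 2 a b / s\<close> has the same limit, which is
therefore a unit vector.\<close>

lemma frenet_frame_asymptote:
  assumes "frenet_frame a T n b" and "a > 0"
  obtains A where "norm A = 1" "\<And>s. s \<ge> 0 \<Longrightarrow> norm (profile a s - s *\<^sub>R A) \<le> 2 * a"
    "\<And>s. s > 0 \<Longrightarrow> norm (T s - A) \<le> 4 * a / s"
proof -
  let ?G = "profile a"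
  note G = profile_eq_frame[OF assms(1)] and dG = profile_has_derivative[OF assms(1)]
  have nb: "norm (b s) = 1" and nT: "norm (T s) = 1" for s
    using frenet_frame_orthonormal(1,3)[OF assms(1), of s] by (simp_all add: norm_eq_sqrt_inner)
  obtain A where A: "norm ((1 / s) *\<^sub>R ?G s - A) \<le> 2 * a / s" if "s > 0" for s
  proof (rule limit_at_top_if_derivative_inverse_square[of "\<lambda>s. (1 / s) *\<^sub>R ?G s"
        "\<lambda>x. - (2 * a / x\<^sup>2) *\<^sub>R b x" "2 * a"])
    fix x :: real assume x: "x > 0"
    have inv: "((\<lambda>x. 1 / x) has_vector_derivative - (1 / x\<^sup>2)) (at x)"
      using x by (auto intro!: derivative_eq_intros simp: power2_eq_square
          simp flip: has_real_derivative_iff_has_vector_derivative)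
    show "((\<lambda>x. (1 / x) *\<^sub>R ?G x) has_vector_derivative - (2 * a / x\<^sup>2) *\<^sub>R b x) (at x)"
      by (rule has_vector_derivative_eq_rhs[OF
            bounded_bilinear.has_vector_derivative[OF bounded_bilinear_scaleR inv dG]])
         (use x in \<open>simp add: G algebra_simps power2_eq_square\<close>)
    show "norm (- (2 * a / x\<^sup>2) *\<^sub>R b x) \<le> 2 * a / x\<^sup>2"
      using assms(2) nb by simp
  qed (use assms(2) in auto)
  have T: "norm (T s - A) \<le> 4 * a / s" if "s > 0" for s
  proof -
    have "T s - A = ((1 / s) *\<^sub>R ?G s - A) - (2 * a / s) *\<^sub>R b s"
      using that by (simp add: G algebra_simps)
    then have "norm (T s - A) \<le> norm ((1 / s) *\<^sub>R ?G s - A) + norm ((2 * a / s) *\<^sub>R b s)"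
      by (metis norm_triangle_ineq4)
    also have "\<dots> \<le> 2 * a / s + 2 * a / s"
      using A[OF that] assms(2) that nb by (intro add_mono) simp_all
    finally show ?thesis by simp
  qed
  show thesis
  proof (rule that[of A])
    have "((\<lambda>s. 4 * a / s) \<longlongrightarrow> 0) at_top"
      by (intro tendsto_divide_0[OF tendsto_const] filterlim_at_top_imp_at_infinity filterlim_ident)
    then have "((\<lambda>s. T s - A) \<longlongrightarrow> 0) at_top"
      by (rule Lim_null_comparison[rotated]) (auto intro: eventually_mono[OF eventually_gt_at_top[of 0]] T)
    then have "(T \<longlongrightarrow> A) at_top" by (simp flip: Lim_null)
    then have "((\<lambda>s. norm (T s)) \<longlongrightarrow> norm A) at_top" by (rule tendsto_norm)
    then show "norm A = 1" by (simp add: nT tendsto_const_iff)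
    show "norm (?G s - s *\<^sub>R A) \<le> 2 * a" if "s \<ge> 0" for s
    proof (cases "s = 0")
      case True
      then show ?thesis using G[of 0] nb assms(2) by simp
    next
      case False
      then have s: "s > 0" using that by simp
      then have "?G s - s *\<^sub>R A = s *\<^sub>R ((1 / s) *\<^sub>R ?G s - A)"
        by (simp add: algebra_simps)
      then have "norm (?G s - s *\<^sub>R A) = s * norm ((1 / s) *\<^sub>R ?G s - A)"
        using s by (metis norm_scaleR abs_of_pos)
      also have "\<dots> \<le> s * (2 * a / s)"
        using A[OF s] s by (intro mult_left_mono) auto
      finally show ?thesis using s by simp
    qed
  qed (rule T)
qed

text \<open>The rotation by \<open>\<pi>\<close> about the first axis.\<close>

definition half_turn :: "real^3 \<Rightarrow> real^3" where
  "half_turn v = vector [v $ 1, - v $ 2, - v $ 3]"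

lemma bounded_linear_half_turn: "bounded_linear half_turn"
  by (rule linear_conv_bounded_linear[THEN iffD1], rule linearI)
     (simp_all add: half_turn_def vec_eq_iff forall_3)

lemma frenet_eqs_reflect:
  assumes "frenet_eqs a T n b"
  shows "frenet_eqs a (\<lambda>s. T (- s)) (\<lambda>s. - n (- s)) (\<lambda>s. - b (- s))"
proof -
  have r: "((\<lambda>s. f (- s)) has_vector_derivative - f') (at s)"
    if "(f has_vector_derivative f') (at (- s))" for f :: "real \<Rightarrow> 'a" and f' s
  proof -
    have "((\<lambda>s. - s) has_vector_derivative -1) (at s)"
      by (intro derivative_eq_intros has_vector_derivative_minus has_vector_derivative_id | simp)+
    from vector_diff_chain_at[OF this that] show ?thesis by (simp add: o_def)
  qed
  note d = frenet_eqsD[OF assms, of "- _"]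
  show ?thesis
    unfolding frenet_eqs_def
    by (intro conjI allI)
       (rule has_vector_derivative_eq_rhs[OF r[OF d(1)]], simp,
        rule has_vector_derivative_eq_rhs[OF has_vector_derivative_minus[OF r[OF d(2)]]], simp,
        rule has_vector_derivative_eq_rhs[OF has_vector_derivative_minus[OF r[OF d(3)]]], simp)
qed

text \<open>Reversing \<open>s\<close> changes the signs of \<open>n\<close> and \<open>b\<close> in the Frenet system; the half turn restores the
initial frame, so uniqueness identifies the two frames.\<close>

lemma profile_reflect:
  assumes "frenet_frame a T n b"
  shows "profile a (- s) = - half_turn (profile a s)"
proof -
  interpret L: bounded_linear half_turn by (rule bounded_linear_half_turn)
  define T' n' b' where "T' = (\<lambda>s. half_turn (T (- s)))" and "n' = (\<lambda>s. half_turn (- n (- s)))"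
    and "b' = (\<lambda>s. half_turn (- b (- s)))"
  have "frenet_eqs a T' n' b'"
    unfolding T'_def n'_def b'_def using assms
    by (intro frenet_eqs_linear_image[OF bounded_linear_half_turn] frenet_eqs_reflect)
       (simp add: frenet_frame_iff)
  moreover have "T' 0 = vector [1, 0, 0]" "n' 0 = vector [0, 1, 0]" "b' 0 = vector [0, 0, 1]"
    using assms by (simp_all add: frenet_frame_def T'_def n'_def b'_def half_turn_def vec_eq_iff forall_3)
  ultimately have *: "frenet_frame a T' n' b'" by (simp add: frenet_frame_iff)
  show ?thesis
    unfolding profile_eq_frame[OF *, of "- s"] profile_eq_frame[OF assms, of s] T'_def b'_def
    by (simp add: L.add L.scaleR L.neg)
qed

section \<open>Self-intersections of the profile\<close>


text \<open>Pythagoras for \<open>G = s T + 2 a b\<close>.\<close>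

lemma norm_profile:
  assumes "frenet_frame a T n b"
  shows "(norm (profile a s))\<^sup>2 = s\<^sup>2 + 4 * a\<^sup>2"
  unfolding power2_norm_eq_inner profile_eq_frame[OF assms]
  using frenet_frame_orthonormal[OF assms, of s]
  by (simp add: inner_simps inner_commute power2_eq_square algebra_simps)

text \<open>Equal points have equal norms, hence parameters of equal modulus. By the symmetry, \<open>G(- s)\<close> is
\<open>G(s)\<close> with the first coordinate negated.\<close>

lemma self_intersections_profile:
  assumes "frenet_frame a T n b"
  shows "self_intersections (profile a) = (\<lambda>s. (s, - s)) ` {s. s \<noteq> 0 \<and> profile a s $ 1 = 0}"
proof -
  have 1: "s1 = s2 \<or> s2 = - s1" if "profile a s1 = profile a s2" for s1 s2
  proof -
    have "s1\<^sup>2 + 4 * a\<^sup>2 = s2\<^sup>2 + 4 * a\<^sup>2"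
      using norm_profile[OF assms, of s1] norm_profile[OF assms, of s2] that by simp
    then show ?thesis by (auto simp: power2_eq_iff)
  qed
  have 2: "profile a s = profile a (- s) \<longleftrightarrow> profile a s $ 1 = 0" for s
    unfolding profile_reflect[OF assms, of s] by (auto simp: half_turn_def vec_eq_iff forall_3)
  have "(s1 \<noteq> s2 \<and> profile a s1 = profile a s2) \<longleftrightarrow> (s1 \<noteq> 0 \<and> profile a s1 $ 1 = 0 \<and> s2 = - s1)"
    for s1 s2
    using 1[of s1 s2] 2[of s1] by (cases "s2 = - s1") auto
  then show ?thesis
    unfolding self_intersections_def by auto
qed

text \<open>By Rolle's theorem between \<open>x\<close> and nearby zeros. Iterating it shows that all derivatives vanish at
an accumulation point of zeros, without any appeal to analyticity.\<close>

lemma islimpt_zeros_derivative: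
  fixes f :: "real \<Rightarrow> real"
  assumes d: "\<And>x. (f has_real_derivative f' x) (at x)" and l: "x islimpt {s. f s = 0}"
  shows "f x = 0" "x islimpt {s. f' s = 0}"
proof -
  have c: "continuous_on UNIV f"
    using d by (intro continuous_at_imp_continuous_on) (auto intro: DERIV_isCont)
  have "closed {s. f s = 0}"
    using continuous_closed_vimage[of "{0}" f] c
    by (auto simp: vimage_def continuous_on_eq_continuous_at)
  then show fx: "f x = 0"
    using l by (auto simp: closed_limpt)
  show "x islimpt {s. f' s = 0}"
    unfolding islimpt_approachable
  proof (intro allI impI)
    fix e :: real assume "e > 0"
    then obtain z where z: "f z = 0" "z \<noteq> x" "dist z x < e"
      using l unfolding islimpt_approachable by auto
    define u v where "u = min x z" and "v = max x z"
    have "\<exists>w. u < w \<and> w < v \<and> (f has_real_derivative 0) (at w)"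
    proof (rule Rolle)
      show "u < v" using z by (auto simp: u_def v_def)
      show "f u = f v" using fx z by (auto simp: u_def v_def min_def max_def)
      show "continuous_on {u..v} f" using c by (rule continuous_on_subset) auto
      show "f differentiable (at w)" for w
        using d real_differentiable_def by blast
    qed
    then obtain w where w: "u < w" "w < v" "(f has_real_derivative 0) (at w)" by blast
    then have "f' w = 0" using d DERIV_unique by blast
    moreover have "w \<noteq> x" "dist w x < e"
      using w z by (auto simp: u_def v_def dist_real_def min_def max_def split: if_splits)
    ultimately show "\<exists>w\<in>{s. f' s = 0}. w \<noteq> x \<and> dist w x < e" by blast
  qed
qed

lemma frenet_frame_first_components:
  assumes "frenet_frame a T n b"
  shows "(T s $ 1)\<^sup>2 + (n s $ 1)\<^sup>2 + (b s $ 1)\<^sup>2 = 1"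
    "\<bar>T s $ 1\<bar> \<le> 1" "\<bar>n s $ 1\<bar> \<le> 1" "\<bar>b s $ 1\<bar> \<le> 1"
    "((\<lambda>s. T s $ 1) has_real_derivative a * n s $ 1) (at s)"
    "((\<lambda>s. n s $ 1) has_real_derivative - a * T s $ 1 + s / 2 * b s $ 1) (at s)"
    "((\<lambda>s. b s $ 1) has_real_derivative - (s / 2) * n s $ 1) (at s)"
    "((\<lambda>s. profile a s $ 1) has_real_derivative T s $ 1) (at s)"
    "profile a s $ 1 = s * T s $ 1 + 2 * a * b s $ 1"
proof -
  show c: "(T s $ 1)\<^sup>2 + (n s $ 1)\<^sup>2 + (b s $ 1)\<^sup>2 = 1"
    using frenet_frame_orthonormal(7)[OF assms, of s 1 1] by (simp add: power2_eq_square)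
  show "\<bar>T s $ 1\<bar> \<le> 1" "\<bar>n s $ 1\<bar> \<le> 1" "\<bar>b s $ 1\<bar> \<le> 1"
    unfolding abs_square_le_1[symmetric]
    using c zero_le_power2[of "T s $ 1"] zero_le_power2[of "n s $ 1"] zero_le_power2[of "b s $ 1"]
    by linarith+
  show "((\<lambda>s. T s $ 1) has_real_derivative a * n s $ 1) (at s)"
    "((\<lambda>s. n s $ 1) has_real_derivative - a * T s $ 1 + s / 2 * b s $ 1) (at s)"
    "((\<lambda>s. b s $ 1) has_real_derivative - (s / 2) * n s $ 1) (at s)"
    using frenet_eqsD[OF frenet_frame_components[OF assms, of 1], of s]
    by (simp_all add: has_real_derivative_iff_has_vector_derivative)
  show "((\<lambda>s. profile a s $ 1) has_real_derivative T s $ 1) (at s)"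
    unfolding has_real_derivative_iff_has_vector_derivative
    by (rule bounded_linear.has_vector_derivative[OF bounded_linear_vec_nth profile_has_derivative[OF assms]])
  show "profile a s $ 1 = s * T s $ 1 + 2 * a * b s $ 1"
    by (simp add: profile_eq_frame[OF assms])
qed

text \<open>At an accumulation point of zeros of \<open>G\<^sub>1\<close> also \<open>G\<^sub>1' = T\<^sub>1\<close> and \<open>T\<^sub>1' = a n\<^sub>1\<close> vanish, hence
\<open>b\<^sub>1 = 0\<close> by \<open>G\<^sub>1 = s T\<^sub>1 + 2 a b\<^sub>1\<close>. This contradicts \<open>T\<^sub>1\<^sup>2 + n\<^sub>1\<^sup>2 + b\<^sub>1\<^sup>2 = 1\<close>.\<close>

lemma finite_profile_zeros:
  assumes "frenet_frame a T n b" "a > 0" and bdd: "\<And>s. profile a s $ 1 = 0 \<Longrightarrow> \<bar>s\<bar> \<le> R"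
  shows "finite {s. profile a s $ 1 = 0}"
proof (rule ccontr)
  note f = frenet_frame_first_components[OF assms(1)]
  assume "infinite {s. profile a s $ 1 = 0}"
  moreover have "{s. profile a s $ 1 = 0} \<subseteq> {- R..R}"
    using bdd by (auto simp: abs_le_iff minus_le_iff)
  ultimately obtain x where x: "x islimpt {s. profile a s $ 1 = 0}"
    using compact_eq_Bolzano_Weierstrass[of "{- R..R}"] by auto
  note 1 = islimpt_zeros_derivative[OF f(8) x]
  note 2 = islimpt_zeros_derivative[OF f(5) 1(2)]
  have "x islimpt {s. n s $ 1 = 0}" using 2(2) assms(2) by simp
  note 3 = islimpt_zeros_derivative[OF f(6) this]
  have "b x $ 1 = 0" using f(9)[of x] 1(1) 2(1) assms(2) by simp
  then show False using f(1)[of x] 2(1) 3(1) by simp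
qed

lemma norm_diff_le_of_real_derivative_le:
  fixes f \<phi> :: "real \<Rightarrow> real"
  assumes "r \<le> s"
    and "\<And>x. r \<le> x \<Longrightarrow> x \<le> s \<Longrightarrow> (f has_real_derivative f' x) (at x)"
    and "\<And>x. r \<le> x \<Longrightarrow> x \<le> s \<Longrightarrow> (\<phi> has_real_derivative \<phi>' x) (at x)"
    and "\<And>x. r \<le> x \<Longrightarrow> x \<le> s \<Longrightarrow> \<bar>f' x\<bar> \<le> \<phi>' x"
  shows "\<bar>f s - f r\<bar> \<le> \<phi> s - \<phi> r"
  using norm_diff_le_of_derivative_le[of r s f f' \<phi> \<phi>'] assms
  by (simp add: has_real_derivative_iff_has_vector_derivative)

lemma profile_reflect_first:
  assumes "frenet_frame a T n b"
  shows "profile a (- s) $ 1 = - profile a s $ 1"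
  by (simp add: profile_reflect[OF assms, of s] half_turn_def)

text \<open>On \<open>[0, 1]\<close> the first coordinate of the tangent drops by at most \<open>a\<close>, so \<open>G\<^sub>1 \<ge> (1 - a) s\<close>. Beyond \<open>1\<close> the slope \<open>G\<^sub>1/s\<close>
changes by less than \<open>2 a\<close>. The bound \<open>a < 1/3\<close> makes \<open>1 - a - 2 a\<close> positive.\<close>

lemma no_self_intersection_small:
  assumes fr: "frenet_frame a T n b" and "0 < a" "a < 1 / 3"
  shows "self_intersections (profile a) = {}"
proof -
  note f = frenet_frame_first_components[OF fr]
  have T: "T s $ 1 \<ge> 1 - a" if "0 \<le> s" "s \<le> 1" for s
  proof -
    have "\<bar>T s $ 1 - T 0 $ 1\<bar> \<le> a * s - a * 0"
      by (rule norm_diff_le_of_real_derivative_le[where \<phi>' = "\<lambda>x. a", OF that(1) f(5)])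
         (use f(3) assms(2) in \<open>auto intro!: derivative_eq_intros simp: abs_mult\<close>)
    moreover have "T 0 $ 1 = 1" using fr by (simp add: frenet_frame_def)
    moreover have "a * s \<le> a" using that assms(2) by simp
    ultimately show ?thesis by linarith
  qed
  have G: "profile a s $ 1 \<ge> (1 - a) * s" if "0 \<le> s" "s \<le> 1" for s
  proof -
    have "profile a 0 $ 1 - (1 - a) * 0 \<le> profile a s $ 1 - (1 - a) * s"
    proof (rule DERIV_nonneg_imp_nondecreasing[OF that(1)])
      fix x assume "0 \<le> x" "x \<le> s"
      then show "\<exists>y. ((\<lambda>s. profile a s $ 1 - (1 - a) * s) has_real_derivative y) (at x) \<and> 0 \<le> y"
        using T[of x] that
        by (intro exI[of _ "T x $ 1 - (1 - a)"] conjI DERIV_diff f(8)) (auto intro!: derivative_eq_intros)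
    qed
    moreover have "profile a 0 $ 1 = 0"
      using f(9)[of 0] fr by (simp add: frenet_frame_def)
    ultimately show ?thesis by simp
  qed
  have G': "profile a s $ 1 > 0" if "s \<ge> 1" for s
  proof -
    have "\<bar>profile a s $ 1 / s - profile a 1 $ 1 / 1\<bar> \<le> (- 2 * a / s) - (- 2 * a / 1)"
    proof (rule norm_diff_le_of_real_derivative_le[where f' = "\<lambda>x. - (2 * a / x\<^sup>2) * b x $ 1"
          and \<phi>' = "\<lambda>x. 2 * a / x\<^sup>2", OF that])
      fix x :: real assume x: "1 \<le> x" "x \<le> s"
      show "((\<lambda>s. profile a s $ 1 / s) has_real_derivative - (2 * a / x\<^sup>2) * b x $ 1) (at x)"
        by (rule DERIV_cong[OF DERIV_divide[OF f(8) DERIV_ident]])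
           (use x in \<open>simp_all add: f(9) field_simps power2_eq_square\<close>)
      show "((/) (- 2 * a) has_real_derivative 2 * a / x\<^sup>2) (at x)"
        using x by (auto intro!: derivative_eq_intros simp: power2_eq_square)
      show "\<bar>- (2 * a / x\<^sup>2) * b x $ 1\<bar> \<le> 2 * a / x\<^sup>2"
        using f(4)[of x] assms(2) x by (simp add: abs_mult mult_left_le divide_simps)
    qed
    moreover have "profile a 1 $ 1 \<ge> 1 - a" using G[of 1] by simp
    moreover have "2 * a / s > 0" using that assms(2) by simp
    ultimately have "profile a s $ 1 / s > 0" using assms(3) by simp
    then show ?thesis using that by (simp add: zero_less_divide_iff)
  qed
  have pos: "profile a s $ 1 > 0" if "s > 0" for s
  proof (cases "s \<le> 1")
    case True
    have "0 < (1 - a) * s" using that assms(3) by simp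
    also have "\<dots> \<le> profile a s $ 1" using G True that by simp
    finally show ?thesis .
  qed (use G' in simp)
  have "profile a s $ 1 \<noteq> 0" if "s \<noteq> 0" for s
    using pos[of s] pos[of "- s"] profile_reflect_first[OF fr, of s] that by (cases "s > 0") auto
  then show ?thesis by (auto simp: self_intersections_profile[OF fr])
qed

text \<open>Without torsion the first coordinates would be those of a circle, \<open>T\<^sub>1 = cos (a s)\<close> and
\<open>G\<^sub>1 = sin (a s) / a\<close>. The torsion perturbs \<open>T\<^sub>1\<close> by at most \<open>s\<^sup>2/2\<close>, thus \<open>G\<^sub>1\<close> by at most
\<open>s\<^sup>3/6\<close>; at \<open>s = 3\<pi>/(2a)\<close> this is smaller than \<open>1/a\<close> when \<open>a\<close> is large. As \<open>G\<^sub>1\<close> is positive for small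
\<open>s > 0\<close>, it has a positive zero.\<close>

lemma self_intersection_large:
  assumes fr: "frenet_frame a T n b" and "a > 6"
  shows "self_intersections (profile a) \<noteq> {}"
proof -
  note f = frenet_frame_first_components[OF fr]
  \<comment> \<open>\<open>(T\<^sub>1, n\<^sub>1)\<close> in the coordinates that rotate with the unperturbed circle; only the torsion
    term survives in their derivatives.\<close>
  define u v where "u = (\<lambda>s. T s $ 1 * cos (a * s) - n s $ 1 * sin (a * s))"
    and "v = (\<lambda>s. T s $ 1 * sin (a * s) + n s $ 1 * cos (a * s))"
  have t: "((\<lambda>s. cos (a * s)) has_real_derivative - a * sin (a * s)) (at s)"
     "((\<lambda>s. sin (a * s)) has_real_derivative a * cos (a * s)) (at s)" for s
    by (rule DERIV_cong[OF DERIV_fun_cos[OF DERIV_cmult[OF DERIV_ident]]], simp)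
       (rule DERIV_cong[OF DERIV_fun_sin[OF DERIV_cmult[OF DERIV_ident]]], simp)
  have u': "(u has_real_derivative - (s / 2) * b s $ 1 * sin (a * s)) (at s)" for s
    unfolding u_def
    by (rule DERIV_cong[OF DERIV_diff[OF DERIV_mult[OF f(5) t(1)] DERIV_mult[OF f(6) t(2)]]])
       (simp add: algebra_simps)
  have v': "(v has_real_derivative s / 2 * b s $ 1 * cos (a * s)) (at s)" for s
    unfolding v_def
    by (rule DERIV_cong[OF DERIV_add[OF DERIV_mult[OF f(5) t(2)] DERIV_mult[OF f(6) t(1)]]])
       (simp add: algebra_simps)
  have i: "u 0 = 1" "v 0 = 0" using fr by (simp_all add: u_def v_def frenet_frame_def)
  have sq: "((\<lambda>s. s\<^sup>2 / 4) has_real_derivative x / 2) (at x)" for x :: real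
    by (auto intro!: derivative_eq_intros)
  have small: "\<bar>x / 2 * b x $ 1 * c\<bar> \<le> x / 2" if "0 \<le> x" "\<bar>c\<bar> \<le> 1" for x c
    using mult_mono[OF f(4)[of x] that(2)] that(1)
    by (auto simp: abs_mult mult.assoc intro: mult_left_le)
  have uv: "\<bar>u s - 1\<bar> \<le> s\<^sup>2 / 4" "\<bar>v s\<bar> \<le> s\<^sup>2 / 4" if "0 \<le> s" for s
    using norm_diff_le_of_real_derivative_le[OF that u' sq] norm_diff_le_of_real_derivative_le[OF that v' sq]
      small i by auto
  have T: "\<bar>T s $ 1 - cos (a * s)\<bar> \<le> s\<^sup>2 / 2" if "0 \<le> s" for s
  proof -
    have "u s * cos (a * s) + v s * sin (a * s) = T s $ 1 * ((sin (a * s))\<^sup>2 + (cos (a * s))\<^sup>2)"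
      unfolding u_def v_def by algebra
    then have "T s $ 1 - cos (a * s) = (u s - 1) * cos (a * s) + v s * sin (a * s)"
      by (simp add: algebra_simps)
    also have "\<bar>\<dots>\<bar> \<le> \<bar>u s - 1\<bar> * \<bar>cos (a * s)\<bar> + \<bar>v s\<bar> * \<bar>sin (a * s)\<bar>"
      by (metis abs_mult abs_triangle_ineq)
    also have "\<dots> \<le> s\<^sup>2 / 4 * 1 + s\<^sup>2 / 4 * 1"
      by (intro add_mono mult_mono uv that) auto
    finally show ?thesis by simp
  qed
  define r where "r = 3 * pi / (2 * a)"
  have r: "r > 0" using assms(2) by (simp add: r_def)
  have "\<bar>(profile a r $ 1 - sin (a * r) / a) - (profile a 0 $ 1 - sin (a * 0) / a)\<bar> \<le> r ^ 3 / 6 - 0 ^ 3 / 6"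
    by (rule norm_diff_le_of_real_derivative_le[where f' = "\<lambda>x. T x $ 1 - cos (a * x)" and \<phi>' = "\<lambda>x. x\<^sup>2 / 2"])
       (use r T assms(2) in \<open>auto intro!: derivative_eq_intros f(8)\<close>)
  moreover have "profile a 0 $ 1 = 0"
    using f(9)[of 0] fr by (simp add: frenet_frame_def)
  moreover have "sin (a * r) = - 1"
  proof -
    have "a * r = 3 / 2 * pi" using assms(2) by (simp add: r_def)
    then show ?thesis by (simp only: sin_3over2_pi)
  qed
  ultimately have "\<bar>profile a r $ 1 + 1 / a\<bar> \<le> r ^ 3 / 6" by simp
  then have *: "profile a r $ 1 \<le> r ^ 3 / 6 - 1 / a" by linarith
  have "r ^ 3 / 6 < 1 / a"
  proof -
    have "(a * r) ^ 3 < 6 * a\<^sup>2"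
    proof -
      have "a * r = 3 / 2 * pi" using assms(2) by (simp add: r_def)
      \<comment> \<open>The crude bound \<open>3\<pi>/2 \<le> 6\<close> is the source of the threshold \<open>6\<close>: it suffices that
        \<open>6\<^sup>3 < 6 a\<^sup>2\<close>.\<close>
      also have "\<dots> \<le> 6" using pi_less_4 by simp
      finally have "(a * r) ^ 3 \<le> 6 ^ 3" using r assms(2) by (intro power_mono) auto
      also have "\<dots> = 6 * (6::real)\<^sup>2" by simp
      also have "\<dots> < 6 * a\<^sup>2" using assms(2) by (intro mult_strict_left_mono power_strict_mono) auto
      finally show ?thesis .
    qed
    then have "a\<^sup>2 * (a * r ^ 3) < a\<^sup>2 * 6"
      by (simp add: power_mult_distrib power3_eq_cube power2_eq_square mult_ac)
    then have "a * r ^ 3 < 6" using assms(2) by (simp add: mult_less_cancel_left)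
    then show ?thesis using assms(2) by (simp add: field_simps)
  qed
  with * have neg: "profile a r $ 1 < 0" by linarith
  obtain d where d: "d > 0" "\<And>h. 0 < h \<Longrightarrow> h < d \<Longrightarrow> profile a 0 $ 1 < profile a (0 + h) $ 1"
    using DERIV_pos_inc_right[OF f(8)[of 0]] fr by (auto simp: frenet_frame_def)
  define h where "h = min (d / 2) (r / 2)"
  have h: "0 < h" "h < d" "h < r" using d(1) r by (auto simp: h_def)
  then have pos: "profile a h $ 1 > 0" using d(2)[of h] \<open>profile a 0 $ 1 = 0\<close> by simp
  have "\<exists>x\<ge>h. x \<le> r \<and> profile a x $ 1 = 0"
    by (rule IVT2) (use neg pos h DERIV_isCont[OF f(8)] in auto)
  then obtain x where "h \<le> x" "profile a x $ 1 = 0" by blast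
  then have "(x, - x) \<in> self_intersections (profile a)"
    using h unfolding self_intersections_profile[OF fr] by simp
  then show ?thesis by blast
qed

section \<open>Integration against the Gamma weight\<close>


text \<open>Differentiation under the integral sign. The mean value inequality bounds the difference quotients
by the same integrable function \<open>g\<close> that bounds the derivative, so dominated convergence
applies along every sequence.\<close>

lemma has_vector_derivative_integral:
  fixes f :: "real \<Rightarrow> 'm \<Rightarrow> 'b::{banach, second_countable_topology}"
  assumes int: "\<And>r. integrable M (f r)"
    and deriv: "\<And>r y. ((\<lambda>r. f r y) has_vector_derivative f' r y) (at r)"
    and meas: "f' s \<in> borel_measurable M"
    and bound: "\<And>r y. norm (f' r y) \<le> g y" and g: "integrable M g"
  shows "((\<lambda>r. \<integral>y. f r y \<partial>M) has_vector_derivative (\<integral>y. f' s y \<partial>M)) (at s)"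
proof -
  have quot: "((\<lambda>r. (1 / (r - s)) *\<^sub>R (h r - h s)) \<longlongrightarrow> h') (at s) \<longleftrightarrow> (h has_vector_derivative h') (at s)"
    for h :: "real \<Rightarrow> 'b" and h'
  proof -
    have "(h has_vector_derivative h') (at s) \<longleftrightarrow>
        ((\<lambda>r. norm (h r - h s - (r - s) *\<^sub>R h') / norm (r - s)) \<longlongrightarrow> 0) (at s)"
      unfolding has_vector_derivative_def has_derivative_iff_norm
      by (simp add: bounded_linear_scaleR_left)
    also have "\<dots> \<longleftrightarrow> ((\<lambda>r. norm ((1 / (r - s)) *\<^sub>R (h r - h s) - h')) \<longlongrightarrow> 0) (at s)"
    proof (rule filterlim_cong[OF refl refl], rule eventually_at_filter[THEN iffD2], rule always_eventually, intro allI impI)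
      fix r assume "r \<noteq> s"
      then have "(1 / (r - s)) *\<^sub>R (h r - h s) - h' = (1 / (r - s)) *\<^sub>R (h r - h s - (r - s) *\<^sub>R h')"
        by (simp add: scaleR_right_diff_distrib)
      then show "norm (h r - h s - (r - s) *\<^sub>R h') / norm (r - s) = norm ((1 / (r - s)) *\<^sub>R (h r - h s) - h')"
        by simp
    qed
    also have "\<dots> \<longleftrightarrow> ((\<lambda>r. (1 / (r - s)) *\<^sub>R (h r - h s)) \<longlongrightarrow> h') (at s)"
      unfolding tendsto_norm_zero_iff Lim_null[symmetric] ..
    finally show ?thesis by blast
  qed
  have mvt: "norm ((1 / (r - s)) *\<^sub>R (f r y - f s y)) \<le> g y" if "r \<noteq> s" for r y
  proof -
    have "norm (f r y - f s y) \<le> g y * norm (r - s)"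
      by (rule differentiable_bound[of UNIV "\<lambda>r. f r y" "\<lambda>r d. d *\<^sub>R f' r y"])
         (use deriv bound in \<open>auto simp: has_vector_derivative_def intro!: onorm_bound order_trans[OF norm_ge_zero bound] mult_left_mono
            simp: mult.commute[of "g y"]\<close>)
    then show ?thesis using that unfolding norm_scaleR by (simp add: field_simps)
  qed
  show ?thesis
    unfolding quot[symmetric] tendsto_at_iff_sequentially o_def
  proof (intro allI impI)
    fix X :: "nat \<Rightarrow> real" assume X: "\<forall>i. X i \<in> UNIV - {s}" "X \<longlonglongrightarrow> s"
    have "(\<lambda>i. \<integral>y. (1 / (X i - s)) *\<^sub>R (f (X i) y - f s y) \<partial>M) \<longlonglongrightarrow> (\<integral>y. f' s y \<partial>M)"
    proof (rule integral_dominated_convergence[where w = g])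
      show "AE y in M. (\<lambda>i. (1 / (X i - s)) *\<^sub>R (f (X i) y - f s y)) \<longlonglongrightarrow> f' s y"
        using deriv[of _ s, folded quot, unfolded tendsto_at_iff_sequentially o_def] X by auto
      show "AE y in M. norm ((1 / (X i - s)) *\<^sub>R (f (X i) y - f s y)) \<le> g y" for i
        using mvt X by auto
      show "(\<lambda>y. (1 / (X i - s)) *\<^sub>R (f (X i) y - f s y)) \<in> borel_measurable M" for i
        using int by (intro borel_measurable_scaleR borel_measurable_diff borel_measurable_const) auto
    qed (use meas g in auto)
    then show "(\<lambda>i. (1 / (X i - s)) *\<^sub>R ((\<integral>y. f (X i) y \<partial>M) - (\<integral>y. f s y \<partial>M))) \<longlonglongrightarrow> (\<integral>y. f' s y \<partial>M)"
      using int by simp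
  qed
qed

text \<open>The integrand of \<open>\<Gamma>(1/2)\<close>. Extending it by zero allows integration over the whole line.\<close>

definition gamma_weight :: "real \<Rightarrow> real" where
  "gamma_weight y = (if y > 0 then exp (- y) / sqrt y else 0)"

lemma gamma_weight_nonneg: "gamma_weight y \<ge> 0"
  by (simp add: gamma_weight_def)

lemma borel_measurable_gamma_weight [measurable]: "gamma_weight \<in> borel_measurable borel"
  unfolding gamma_weight_def by measurable

lemma borel_measurable_cis [measurable]: "cis \<in> borel_measurable borel"
  by (intro borel_measurable_continuous_onI continuous_intros)

text \<open>For \<open>y > 0\<close> the integrand of the Gamma integral at \<open>1/2 - i \<mu>\<close> is the weight times the phase
\<open>y\<^bsup>- i \<mu>\<^esup>\<close>.\<close>

lemma gamma_weight_integral: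
  fixes \<mu> :: real
  defines "f \<equiv> (\<lambda>y. gamma_weight y *\<^sub>R cis (- \<mu> * ln y))"
  shows "integrable lborel f" "integral\<^sup>L lborel f = Gamma (1 / 2 - \<i> * of_real \<mu>)"
proof -
  let ?z = "1 / 2 - \<i> * complex_of_real \<mu>"
  let ?F = "\<lambda>t. complex_of_real t powr (?z - 1) / of_real (exp t)"
  have F: "indicator {0<..} t *\<^sub>R ?F t = f t" for t
  proof (cases "t > 0")
    case True
    have "(?z - 1) * Ln (complex_of_real t) = of_real (- (ln t / 2)) + \<i> * of_real (- \<mu> * ln t)"
      using True by (simp add: Ln_of_real algebra_simps)
    then have "complex_of_real t powr (?z - 1) = exp (of_real (- (ln t / 2)) + \<i> * of_real (- \<mu> * ln t))"
      using True by (simp add: powr_def)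
    also have "\<dots> = of_real (exp (- (ln t / 2))) * cis (- \<mu> * ln t)"
      unfolding exp_add cis_conv_exp exp_of_real ..
    also have "exp (- (ln t / 2)) = 1 / sqrt t"
      using True by (simp add: exp_minus ln_sqrt[symmetric] inverse_eq_divide)
    finally show ?thesis
      using True by (simp add: f_def gamma_weight_def exp_minus scaleR_conv_of_real field_simps)
  qed (simp add: f_def gamma_weight_def)
  have m: "f \<in> borel_measurable lborel" unfolding f_def by measurable
  have a: "?F absolutely_integrable_on {0<..}"
    by (rule absolutely_integrable_Gamma_integral') simp
  then have "integrable lebesgue f"
    unfolding set_integrable_def F .
  then show "integrable lborel f"
    using integrable_completion[OF m] by simp
  have "integral\<^sup>L lebesgue f = integral {0<..} ?F"
    using set_lebesgue_integral_eq_integral(2)[OF a] unfolding set_lebesgue_integral_def F .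
  also have "\<dots> = Gamma ?z"
    by (rule integral_unique[OF Gamma_integral_complex']) simp
  finally show "integral\<^sup>L lborel f = Gamma ?z"
    using integral_completion[OF m] by simp
qed

lemma integrable_gamma_weight: "integrable lborel gamma_weight"
  using integrable_norm[OF gamma_weight_integral(1)[of 0]] gamma_weight_nonneg by simp

lemma integral_gamma_weight: "integral\<^sup>L lborel gamma_weight = sqrt pi"
proof -
  have "complex_of_real (integral\<^sup>L lborel gamma_weight) = Gamma (1 / 2)"
    using gamma_weight_integral(2)[of 0] by (simp add: scaleR_conv_of_real)
  also have "\<dots> = of_real (Gamma (1 / 2))"
    using Gamma_complex_of_real[of "1 / 2"] by simp
  finally show ?thesis by (simp only: Gamma_one_half_real of_real_eq_iff)
qed

lemma integrable_sqrt_gamma_weight: "integrable lborel (\<lambda>y. sqrt y * gamma_weight y)"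
proof -
  have "(\<lambda>t. complex_of_real t powr (1 - 1) / of_real (exp t)) absolutely_integrable_on {0<..}"
    by (rule absolutely_integrable_Gamma_integral') simp
  then have "integrable lebesgue (\<lambda>t. norm (indicator {0<..} t *\<^sub>R (complex_of_real t powr (1 - 1) / of_real (exp t))))"
    unfolding set_integrable_def by (rule integrable_norm)
  also have "(\<lambda>t. norm (indicator {0<..} t *\<^sub>R (complex_of_real t powr (1 - 1) / of_real (exp t))))
      = (\<lambda>y. sqrt y * gamma_weight y)"
    by (auto simp: gamma_weight_def fun_eq_iff exp_minus norm_divide norm_inverse divide_inverse)
  finally show ?thesis
    by (subst (asm) integrable_completion) auto
qed

lemma integrable_weighted:
  fixes h :: "real \<Rightarrow> complex"
  assumes "integrable lborel (w :: real \<Rightarrow> real)" "h \<in> borel_measurable borel" "\<And>y. norm (h y) \<le> B"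
  shows "integrable lborel (\<lambda>y. w y *\<^sub>R h y)"
proof (rule Bochner_Integration.integrable_bound)
  show "integrable lborel (\<lambda>y. B * w y)" using assms(1) by simp
  show "(\<lambda>y. w y *\<^sub>R h y) \<in> borel_measurable lborel"
    using borel_measurable_integrable[OF assms(1)] assms(2) by simp
  show "AE y in lborel. norm (w y *\<^sub>R h y) \<le> norm (B * w y)"
  proof (rule AE_I2)
    fix y
    have "norm (h y) \<le> \<bar>B\<bar>" using assms(3)[of y] by linarith
    then show "norm (w y *\<^sub>R h y) \<le> norm (B * w y)"
      by (simp add: abs_mult mult.commute[of "\<bar>B\<bar>"] mult_left_mono)
  qed
qed

lemma cos_imaginary: "cos (\<i> * complex_of_real x) = of_real (cosh x)"
  by (simp add: cos_exp_eq cosh_def exp_of_real exp_minus add.commute)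

text \<open>The points \<open>z = 1/2 - i \<mu>\<close> and \<open>1 - z\<close> are conjugate, so the reflection formula computes the
squared modulus.\<close>

lemma norm_Gamma_half_minus:
  "(norm (Gamma (1 / 2 - \<i> * complex_of_real \<mu>)))\<^sup>2 * cosh (pi * \<mu>) = pi"
proof -
  let ?z = "1 / 2 - \<i> * complex_of_real \<mu>"
  have "of_real ((norm (Gamma ?z))\<^sup>2) = Gamma ?z * cnj (Gamma ?z)"
    by (rule complex_norm_square)
  also have "cnj (Gamma ?z) = Gamma (1 - ?z)"
    by (simp add: cnj_Gamma)
  also have "Gamma ?z * Gamma (1 - ?z) = of_real pi / sin (of_real pi * ?z)"
    by (rule Gamma_reflection_complex)
  also have "of_real pi * ?z = of_real pi / 2 - \<i> * of_real (pi * \<mu>)"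
    by (simp add: algebra_simps)
  also have "sin (of_real pi / 2 - \<i> * of_real (pi * \<mu>)) = cos (\<i> * of_real (pi * \<mu>))"
    by (simp add: sin_diff)
  also have "\<dots> = of_real (cosh (pi * \<mu>))"
    by (rule cos_imaginary)
  finally have "complex_of_real ((norm (Gamma ?z))\<^sup>2) = of_real (pi / cosh (pi * \<mu>))" by simp
  then have "(norm (Gamma ?z))\<^sup>2 = pi / cosh (pi * \<mu>)"
    by (simp only: of_real_eq_iff)
  then show ?thesis by simp
qed

section \<open>Asymptotics of the spinor and its weighted transform\<close>


text \<open>Write \<open>E = s\<^bsup>i a\<^sup>2/2\<^esup>\<close>. In the derivative of \<open>E p\<close> the term with \<open>q\<close> oscillates but is not
integrable in absolute value. The correction \<open>a q / s\<close> performs one integration by parts: all terms of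
order \<open>1\<close> and \<open>1/s\<close> cancel in \<open>(E (p + a q / s))'\<close>, and what remains is of order \<open>1/s\<^sup>2\<close>.\<close>

lemma spinor_asymptotics:
  assumes sp: "spinor a p q" and "a > 0"
  obtains C K where "\<And>s. s > 0 \<Longrightarrow> norm (p s - C * cis (- (a\<^sup>2 / 2 * ln s))) \<le> K / s"
proof -
  define E where "E = (\<lambda>s. cis (a\<^sup>2 / 2 * ln s))"
  define X where "X = (\<lambda>s. E s * (p s + of_real (a / s) * q s))"
  note q1 = spinor_le_one(2)[OF sp]
  note d = spinorD(1,2)[OF sp]
  note m = has_vector_derivative_mult
  have E': "(E has_vector_derivative \<i> * of_real (a\<^sup>2 / 2 / s) * E s) (at s)" if "s > 0" for s
  proof -
    have "((\<lambda>z. exp (\<i> * of_real (a\<^sup>2 / 2) * of_real z)) has_vector_derivative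
        (\<i> * of_real (a\<^sup>2 / 2)) * exp (\<i> * of_real (a\<^sup>2 / 2) * of_real z)) (at z)" for z :: real
      by (rule has_vector_derivative_real_field) (auto intro!: derivative_eq_intros)
    moreover have "(ln has_vector_derivative 1 / s) (at s)"
      using that by (auto intro!: derivative_eq_intros simp flip: has_real_derivative_iff_has_vector_derivative)
    ultimately have "((\<lambda>z. exp (\<i> * of_real (a\<^sup>2 / 2) * of_real z)) \<circ> ln has_vector_derivative
        (1 / s) *\<^sub>R ((\<i> * of_real (a\<^sup>2 / 2)) * exp (\<i> * of_real (a\<^sup>2 / 2) * of_real (ln s)))) (at s)"
      by (intro vector_diff_chain_at)
    then show ?thesis
      by (simp add: E_def o_def cis_conv_exp scaleR_conv_of_real mult_ac)
  qed
  obtain C where C: "norm (X s - C) \<le> a * (1 + a\<^sup>2 / 2) / s" if "s > 0" for s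
  proof (rule limit_at_top_if_derivative_inverse_square[of X
        "\<lambda>s. E s * (q s * (of_real (a / s\<^sup>2) * (\<i> * of_real (a\<^sup>2 / 2) - 1)))" "a * (1 + a\<^sup>2 / 2)"])
    fix s :: real assume s: "s > 0"
    have "((\<lambda>s. a / s) has_real_derivative - (a / s\<^sup>2)) (at s)"
      using s by (auto intro!: derivative_eq_intros simp: power2_eq_square)
    from has_vector_derivative_of_real[OF this]
    have inv: "((\<lambda>s. complex_of_real (a / s)) has_vector_derivative of_real (- (a / s\<^sup>2))) (at s)" .
    show "(X has_vector_derivative E s * (q s * (of_real (a / s\<^sup>2) * (\<i> * of_real (a\<^sup>2 / 2) - 1)))) (at s)"
      unfolding X_def
      by (rule has_vector_derivative_eq_rhs[OF m[OF E'[OF s] has_vector_derivative_add[OF d(1) m[OF inv d(2)]]]])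
         (use s in \<open>simp add: field_simps power2_eq_square\<close>)
    have "norm (\<i> * of_real (a\<^sup>2 / 2) - 1 :: complex) \<le> a\<^sup>2 / 2 + 1"
      using norm_triangle_ineq4[of "\<i> * of_real (a\<^sup>2 / 2) :: complex" 1] by (simp add: norm_mult norm_divide norm_power)
    then have "norm (q s) * (a / s\<^sup>2 * norm (\<i> * of_real (a\<^sup>2 / 2) - 1 :: complex)) \<le> 1 * (a / s\<^sup>2 * (a\<^sup>2 / 2 + 1))"
      using q1[of s] s assms(2) by (intro mult_mono mult_nonneg_nonneg) auto
    moreover have "norm (of_real (a / s\<^sup>2) :: complex) = a / s\<^sup>2"
      using assms(2) unfolding norm_of_real by simp
    moreover have "norm (E s) = 1" by (simp add: E_def)
    ultimately show "norm (E s * (q s * (of_real (a / s\<^sup>2) * (\<i> * of_real (a\<^sup>2 / 2) - 1)))) \<le> a * (1 + a\<^sup>2 / 2) / s\<^sup>2"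
      unfolding norm_mult using assms(2) by (simp add: add.commute del: of_real_divide)
  qed (use assms(2) in auto)
  have "norm (p s - C * cis (- (a\<^sup>2 / 2 * ln s))) \<le> (a * (1 + a\<^sup>2 / 2) + a) / s" if "s > 0" for s
  proof -
    have "E s * (p s - C * cis (- (a\<^sup>2 / 2 * ln s))) = E s * p s - C * (E s * cis (- (a\<^sup>2 / 2 * ln s)))"
      by (simp add: algebra_simps)
    also have "E s * cis (- (a\<^sup>2 / 2 * ln s)) = 1"
      unfolding E_def cis_mult by simp
    finally have "E s * (p s - C * cis (- (a\<^sup>2 / 2 * ln s))) = (X s - C) - E s * (of_real (a / s) * q s)"
      by (simp add: X_def algebra_simps)
    moreover have "norm (E s * (p s - C * cis (- (a\<^sup>2 / 2 * ln s)))) = norm (p s - C * cis (- (a\<^sup>2 / 2 * ln s)))"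
      unfolding norm_mult by (simp add: E_def)
    ultimately have "norm (p s - C * cis (- (a\<^sup>2 / 2 * ln s))) \<le> norm (X s - C) + norm (E s * (of_real (a / s) * q s))"
      by (metis norm_triangle_ineq4)
    moreover have "norm (E s * (of_real (a / s) * q s)) \<le> a / s"
      using q1[of s] that assms(2) by (simp add: norm_mult norm_divide E_def mult_left_le divide_right_mono)
    ultimately show ?thesis
      using C[OF that] by (simp add: add_divide_distrib)
  qed
  then show thesis by (rule that)
qed

text \<open>A Laplace-type transform of \<open>p\<close> in the variable \<open>s\<^sup>2\<close>, scaled so that it interpolates between \<open>p(0)\<close>
for \<open>r = 0\<close> and the behaviour of \<open>p\<close> at infinity for large \<open>r\<close>.\<close>

definition spinor_transform :: "(real \<Rightarrow> complex) \<Rightarrow> real \<Rightarrow> complex" where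
  "spinor_transform p r = (\<integral>y. gamma_weight y *\<^sub>R p (r * sqrt y) \<partial>lborel)"

text \<open>The integral of the derivative of \<open>e\<^bsup>-y\<^esup> q(r \<surd>y)\<close> over \<open>y > 0\<close> vanishes since \<open>q(0) = 0\<close>. The
spinor equation expresses \<open>q'\<close> through \<open>q\<close> and \<open>p\<close>, and the factor \<open>s\<close> in it cancels the
\<open>\<surd>y\<close> from the chain rule.\<close>

lemma spinor_integration_by_parts:
  assumes sp: "spinor a p q"
  shows "(\<i> * r\<^sup>2 / 4 - 1) * (\<integral>y. (sqrt y * gamma_weight y) *\<^sub>R q (r * sqrt y) \<partial>lborel)
     = \<i> * a * r / 4 * spinor_transform p r"
proof -
  note d = spinorD(1,2)[OF sp]
  note le1 = spinor_le_one[OF sp] and cont = spinor_continuous[OF sp]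
  have meas [measurable]: "p \<in> borel_measurable borel" "q \<in> borel_measurable borel"
    using cont by (auto intro: borel_measurable_continuous_onI)
  define f where "f = (\<lambda>y. (\<i> * r\<^sup>2 / 4 - 1) * ((sqrt y * gamma_weight y) *\<^sub>R q (r * sqrt y))
     - \<i> * a * r / 4 * (gamma_weight y *\<^sub>R p (r * sqrt y)))"
  define F where "F = (\<lambda>y. exp (- y) *\<^sub>R q (r * sqrt y))"
  have F': "(F has_vector_derivative f y) (at y)" if "y > 0" for y
  proof -
    have "((\<lambda>y. r * sqrt y) has_vector_derivative r / (2 * sqrt y)) (at y)"
      using that by (auto intro!: derivative_eq_intros simp: field_simps
          simp flip: has_real_derivative_iff_has_vector_derivative)
    from vector_diff_chain_at[OF this d(2)]
    have 1: "((\<lambda>y. q (r * sqrt y)) has_vector_derivative (r / (2 * sqrt y)) *\<^sub>R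
        (\<i> * of_real (r * sqrt y) / 2 * q (r * sqrt y) - \<i> * a / 2 * p (r * sqrt y))) (at y)"
      by (simp add: o_def)
    have 2: "((\<lambda>y. exp (- y)) has_vector_derivative - exp (- y)) (at y)"
      by (auto intro!: derivative_eq_intros simp flip: has_real_derivative_iff_has_vector_derivative)
    have sq: "complex_of_real (sqrt y) * complex_of_real (sqrt y) = of_real y"
      using that by (simp flip: of_real_mult)
    show ?thesis
      unfolding F_def
      by (rule has_vector_derivative_eq_rhs[OF bounded_bilinear.has_vector_derivative[OF bounded_bilinear_scaleR 2 1]])
         (use that sq in \<open>simp add: f_def gamma_weight_def scaleR_conv_of_real field_simps power2_eq_square\<close>)
  qed
  have i1: "integrable lborel (\<lambda>y. (sqrt y * gamma_weight y) *\<^sub>R q (r * sqrt y))"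
    by (rule integrable_weighted[OF integrable_sqrt_gamma_weight _ le1(2)]) measurable
  have i2: "integrable lborel (\<lambda>y. gamma_weight y *\<^sub>R p (r * sqrt y))"
    by (rule integrable_weighted[OF integrable_gamma_weight _ le1(1)]) measurable
  have fi: "integrable lborel f"
    unfolding f_def by (intro Bochner_Integration.integrable_diff integrable_mult_right i1 i2)
  have f0: "indicator {0<..} y *\<^sub>R f y = f y" for y
    by (auto simp: f_def gamma_weight_def)
  have e: "einterval 0 \<infinity> = {0<..}"
    by (auto simp: einterval_def)
  have "(LBINT y=0..\<infinity>. f y) = 0 - 0"
  proof (rule interval_integral_FTC_integrable[where F = F])
    show "set_integrable lborel (einterval 0 \<infinity>) f"
      unfolding set_integrable_def e f0 by (rule fi)
    show "(F has_vector_derivative f y) (at y)" if "0 < ereal y" for y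
      using that by (intro F') simp
    show "isCont f y" if "0 < ereal y" for y
    proof -
      have y: "y > 0" using that by simp
      have c: "isCont (\<lambda>y. g (r * sqrt y)) y" if "continuous_on UNIV g" for g :: "real \<Rightarrow> complex"
        by (rule isCont_o2[where g = g])
          (use that in \<open>auto simp: continuous_on_eq_continuous_at intro!: continuous_intros\<close>)
      have "isCont (\<lambda>y. (\<i> * r\<^sup>2 / 4 - 1) * (exp (- y) *\<^sub>R q (r * sqrt y))
          - \<i> * a * r / 4 * ((exp (- y) / sqrt y) *\<^sub>R p (r * sqrt y))) y"
        by (intro continuous_diff continuous_mult_left continuous_scaleR c cont continuous_divide
            continuous_exp continuous_minus continuous_real_sqrt continuous_ident) (use y in simp)
      moreover have "\<forall>\<^sub>F x in nhds y. f x = (\<i> * r\<^sup>2 / 4 - 1) * (exp (- x) *\<^sub>R q (r * sqrt x))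
          - \<i> * a * r / 4 * ((exp (- x) / sqrt x) *\<^sub>R p (r * sqrt x))"
        by (rule eventually_mono[OF eventually_nhds_in_open[of "{0<..}" y]])
           (use y in \<open>simp_all add: f_def gamma_weight_def\<close>)
      ultimately show ?thesis by (subst isCont_cong)
    qed
    have "(F \<longlongrightarrow> F 0) (at_right 0)"
      unfolding F_def using cont(2)
      by (intro tendsto_intros isCont_tendsto_compose[of _ q]) (auto simp: continuous_on_eq_continuous_at)
    then show "((F \<circ> real_of_ereal) \<longlongrightarrow> 0) (at_right 0)"
      using ereal_tendsto_simps(2)[of F 0 0] spinorD(4)[OF sp] by (simp add: F_def zero_ereal_def)
    have "(F \<longlongrightarrow> 0) at_top"
    proof (rule Lim_null_comparison)
      show "((\<lambda>y::real. exp (- y)) \<longlongrightarrow> 0) at_top"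
        by (rule filterlim_compose[OF exp_at_bot filterlim_uminus_at_bot_at_top])
      show "\<forall>\<^sub>F y in at_top. norm (F y) \<le> exp (- y)"
        using le1(2) by (intro always_eventually) (auto simp: F_def mult_left_le)
    qed
    then show "((F \<circ> real_of_ereal) \<longlongrightarrow> 0) (at_left \<infinity>)"
      using ereal_tendsto_simps(3)[of F 0] by simp
  qed simp
  also have "(LBINT y=0..\<infinity>. f y) = integral\<^sup>L lborel f"
    unfolding zero_ereal_def interval_integral_to_infinity_eq set_lebesgue_integral_def f0 ..
  finally have "integral\<^sup>L lborel f = 0" by simp
  moreover have "integral\<^sup>L lborel f = (\<i> * r\<^sup>2 / 4 - 1) * (\<integral>y. (sqrt y * gamma_weight y) *\<^sub>R q (r * sqrt y) \<partial>lborel)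
     - \<i> * a * r / 4 * spinor_transform p r"
    unfolding f_def spinor_transform_def
      Bochner_Integration.integral_diff[OF integrable_mult_right[OF i1] integrable_mult_right[OF i2]]
      integral_mult_right_zero ..
  ultimately show ?thesis by simp
qed

text \<open>Differentiation under the integral produces the integral of \<open>q\<close>, which the integration by parts
turns back into the transform itself.\<close>

lemma spinor_transform_derivative:
  assumes sp: "spinor a p q" and "a > 0"
  shows "(spinor_transform p has_vector_derivative
     of_real (a\<^sup>2 * r / 2) / (\<i> * of_real (r\<^sup>2) - 4) * spinor_transform p r) (at r)"
proof -
  note d = spinorD(1,2)[OF sp]
  note le1 = spinor_le_one[OF sp] and cont = spinor_continuous[OF sp]
  have meas [measurable]: "p \<in> borel_measurable borel" "q \<in> borel_measurable borel"
    using cont by (auto intro: borel_measurable_continuous_onI)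
  let ?J = "\<integral>y. (sqrt y * gamma_weight y) *\<^sub>R q (r * sqrt y) \<partial>lborel"
  let ?f' = "\<lambda>r y. (sqrt y * gamma_weight y) *\<^sub>R (- (\<i> * a / 2 * q (r * sqrt y)))"
  have "(spinor_transform p has_vector_derivative (\<integral>y. ?f' r y \<partial>lborel)) (at r)"
    unfolding spinor_transform_def
  proof (rule has_vector_derivative_integral[where g = "\<lambda>y. a / 2 * (sqrt y * gamma_weight y)"])
    show "integrable lborel (\<lambda>y. gamma_weight y *\<^sub>R p (r * sqrt y))" for r
      by (rule integrable_weighted[OF integrable_gamma_weight _ le1(1)]) measurable
    show "((\<lambda>r. gamma_weight y *\<^sub>R p (r * sqrt y)) has_vector_derivative ?f' r y) (at r)" for r y
    proof -
      have "((\<lambda>r. r * sqrt y) has_vector_derivative sqrt y) (at r)"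
        by (auto intro!: derivative_eq_intros simp flip: has_real_derivative_iff_has_vector_derivative)
      from vector_diff_chain_at[OF this d(1)]
      have "((\<lambda>r. p (r * sqrt y)) has_vector_derivative sqrt y *\<^sub>R - (\<i> * a / 2 * q (r * sqrt y))) (at r)"
        by (simp add: o_def)
      from bounded_linear.has_vector_derivative[OF bounded_linear_scaleR_right this, of "gamma_weight y"]
      show ?thesis by (simp add: mult.commute)
    qed
    show "?f' r \<in> borel_measurable lborel" by measurable
    show "norm (?f' r y) \<le> a / 2 * (sqrt y * gamma_weight y)" for r y
    proof -
      have nn: "0 \<le> sqrt y * gamma_weight y" by (simp add: gamma_weight_def)
      then have "norm (?f' r y) = sqrt y * gamma_weight y * (a / 2 * norm (q (r * sqrt y)))"
        unfolding norm_scaleR norm_minus_cancel abs_of_nonneg[OF nn] using assms(2)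
        by (simp add: norm_mult norm_divide)
      also have "\<dots> \<le> sqrt y * gamma_weight y * (a / 2 * 1)"
        using assms(2) le1(2) by (intro mult_left_mono nn) auto
      finally show ?thesis by (simp add: mult_ac)
    qed
    show "integrable lborel (\<lambda>y. a / 2 * (sqrt y * gamma_weight y))"
      using integrable_sqrt_gamma_weight by simp
  qed
  moreover have "(\<integral>y. ?f' r y \<partial>lborel) = - (\<i> * a / 2) * ?J"
  proof -
    have "(\<integral>y. ?f' r y \<partial>lborel) = (\<integral>y. - (\<i> * a / 2) * ((sqrt y * gamma_weight y) *\<^sub>R q (r * sqrt y)) \<partial>lborel)"
      by (intro Bochner_Integration.integral_cong) (auto simp: scaleR_conv_of_real mult_ac)
    also have "\<dots> = - (\<i> * a / 2) * ?J" by (rule integral_mult_right_zero)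
    finally show ?thesis .
  qed
  moreover have "- (\<i> * a / 2) * ?J = of_real (a\<^sup>2 * r / 2) / (\<i> * of_real (r\<^sup>2) - 4) * spinor_transform p r"
  proof -
    have J: "(\<i> * r\<^sup>2 / 4 - 1) * ?J = \<i> * a * r / 4 * spinor_transform p r"
      using spinor_integration_by_parts[OF sp, of r] by simp
    have "Re (\<i> * of_real (r\<^sup>2) - 4) \<noteq> 0" by simp
    then have nz: "\<i> * of_real (r\<^sup>2) - 4 \<noteq> (0::complex)" by (metis zero_complex.simps(1))
    have "(\<i> * of_real (r\<^sup>2) - 4) * (- (\<i> * a / 2) * ?J) = - (\<i> * a / 2) * 4 * ((\<i> * r\<^sup>2 / 4 - 1) * ?J)"
      by (simp add: field_simps)
    also have "\<dots> = of_real (a\<^sup>2 * r / 2) * spinor_transform p r"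
      unfolding J by (simp add: power2_eq_square)
    finally show ?thesis using nz by (simp add: field_simps)
  qed
  ultimately show ?thesis by (simp only:)
qed

section \<open>The limiting amplitude of the spinor\<close>


text \<open>Only the real part of the logarithmic derivative matters for the modulus; it is
\<open>- 2 a\<^sup>2 r / (16 + r\<^sup>4)\<close>, the derivative of \<open>- (a\<^sup>2/4) arctan (r\<^sup>2/4)\<close>. The initial value is
\<open>\<Gamma>(1/2) = \<surd>\<pi>\<close>.\<close>

lemma spinor_transform_norm:
  assumes sp: "spinor a p q" and "a > 0"
  shows "(norm (spinor_transform p r))\<^sup>2 = pi * exp (- (a\<^sup>2 / 2 * arctan (r\<^sup>2 / 4)))"
proof -
  let ?h = "spinor_transform p"
  define k where "k = (\<lambda>r. complex_of_real (a\<^sup>2 * r / 2) / (\<i> * of_real (r\<^sup>2) - 4))"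
  have h': "(?h has_vector_derivative k r * ?h r) (at r)" for r
    unfolding k_def by (rule spinor_transform_derivative[OF assms])
  have Rek: "Re (k r) = - (2 * a\<^sup>2 * r / (16 + r ^ 4))" for r
  proof -
    have "16 + r ^ 4 > 0" by (simp add: add_pos_nonneg)
    then have "64 + 4 * (r * (r * (r * r))) \<noteq> 0" "16 + r * r * r * r \<noteq> 0"
      by (simp_all add: power4_eq_xxxx mult.assoc)
    then show ?thesis
      unfolding k_def
      by (simp add: Re_divide power2_eq_square power4_eq_xxxx add.commute frac_eq_eq)
  qed
  define N where "N = (\<lambda>r. Re (cnj (?h r) * ?h r))"
  have N: "N r = (norm (?h r))\<^sup>2" for r
    unfolding N_def cmod_power2 by (simp add: power2_eq_square)
  have N': "(N has_real_derivative - (4 * a\<^sup>2 * r / (16 + r ^ 4)) * N r) (at r)" for r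
  proof -
    have "(N has_vector_derivative Re (cnj (?h r) * (k r * ?h r) + cnj (k r * ?h r) * ?h r)) (at r)"
      unfolding N_def by (intro has_vector_derivative_Re has_vector_derivative_mult has_vector_derivative_cnj h')
    also have "cnj (?h r) * (k r * ?h r) + cnj (k r * ?h r) * ?h r = (k r + cnj (k r)) * (cnj (?h r) * ?h r)"
      by (simp add: algebra_simps)
    also have "Re \<dots> = 2 * Re (k r) * N r"
      by (simp only: complex_add_cnj N_def) simp
    finally show ?thesis
      by (simp add: has_real_derivative_iff_has_vector_derivative Rek mult.assoc)
  qed
  have e': "((\<lambda>r. exp (a\<^sup>2 / 2 * arctan (r\<^sup>2 / 4))) has_real_derivative
      exp (a\<^sup>2 / 2 * arctan (r\<^sup>2 / 4)) * (4 * a\<^sup>2 * r / (16 + r ^ 4))) (at r)" for r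
  proof -
    have "((\<lambda>r. exp (a\<^sup>2 / 2 * arctan (r\<^sup>2 / 4))) has_real_derivative
      exp (a\<^sup>2 / 2 * arctan (r\<^sup>2 / 4)) * (a\<^sup>2 / 2 * (inverse (1 + (r\<^sup>2 / 4)\<^sup>2) * (2 * r / 4)))) (at r)"
    proof (intro DERIV_fun_exp DERIV_cmult DERIV_chain2[OF DERIV_arctan])
      show "((\<lambda>r. r\<^sup>2 / 4) has_real_derivative 2 * r / 4) (at r)"
        by (auto intro!: derivative_eq_intros)
    qed
    moreover have "16 + r ^ 4 \<noteq> 0" by (smt (verit) zero_le_even_power even_numeral)
    then have "a\<^sup>2 / 2 * (inverse (1 + (r\<^sup>2 / 4)\<^sup>2) * (2 * r / 4)) = 4 * a\<^sup>2 * r / (16 + r ^ 4)"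
      by (simp add: power_divide field_simps power2_eq_square power4_eq_xxxx)
    ultimately show ?thesis by (simp only:)
  qed
  have "((\<lambda>r. N r * exp (a\<^sup>2 / 2 * arctan (r\<^sup>2 / 4))) has_vector_derivative 0) (at r)" for r
    unfolding has_real_derivative_iff_has_vector_derivative[symmetric]
    by (rule DERIV_cong[OF DERIV_mult[OF N' e']]) (simp add: algebra_simps)
  from zero_derivative_imp_constant[of "\<lambda>r. N r * exp (a\<^sup>2 / 2 * arctan (r\<^sup>2 / 4))", OF this, of r 0]
  have "N r * exp (a\<^sup>2 / 2 * arctan (r\<^sup>2 / 4)) = N 0" by simp
  moreover have "N 0 = pi"
  proof -
    have "?h 0 = of_real (sqrt pi)"
      using integral_gamma_weight spinorD(3)[OF sp]
      by (simp add: spinor_transform_def scaleR_conv_of_real)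
    then show ?thesis unfolding N by simp
  qed
  ultimately show ?thesis
    unfolding N by (simp add: exp_minus field_simps)
qed

text \<open>After multiplication by the phase \<open>E(r)\<close> the integrand converges pointwise to the weight times
\<open>C y\<^bsup>- i a\<^sup>2/4\<^esup>\<close>, because \<open>ln (r \<surd>y) = ln r + ln y / 2\<close>.\<close>

lemma spinor_transform_limit:
  assumes sp: "spinor a p q"
    and C: "\<And>s. s > 0 \<Longrightarrow> norm (p s - C * cis (- (a\<^sup>2 / 2 * ln s))) \<le> K / s"
  shows "((\<lambda>r. norm (spinor_transform p r)) \<longlongrightarrow> norm (C * Gamma (1 / 2 - \<i> * of_real (a\<^sup>2 / 4)))) at_top"
proof -
  note le1 = spinor_le_one(1)[OF sp]
  have meas [measurable]: "p \<in> borel_measurable borel"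
    by (rule borel_measurable_continuous_onI[OF spinor_continuous(1)[OF sp]])
  let ?c = "\<lambda>y. cis (- (a\<^sup>2 / 4) * ln y)" and ?G = "Gamma (1 / 2 - \<i> * complex_of_real (a\<^sup>2 / 4))"
  define E where "E = (\<lambda>r. cis (a\<^sup>2 / 2 * ln r))"
  have split: "cis (- (a\<^sup>2 / 2 * ln (r * sqrt y))) = cnj (E r) * ?c y" if "r > 0" "y > 0" for r y
  proof -
    have "- (a\<^sup>2 / 2 * ln (r * sqrt y)) = - (a\<^sup>2 / 2 * ln r) + - (a\<^sup>2 / 4) * ln y"
      using that by (simp add: ln_mult ln_sqrt field_simps)
    then show ?thesis unfolding E_def cis_cnj cis_mult by simp
  qed
  have "((\<lambda>r. \<integral>y. gamma_weight y *\<^sub>R (E r * p (r * sqrt y) - C * ?c y) \<partial>lborel) \<longlongrightarrow> (\<integral>y. 0 \<partial>(lborel :: real measure))) at_top"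
  proof (rule integral_dominated_convergence_at_top[where w = "\<lambda>y. (1 + norm C) * gamma_weight y"
        and s = "\<lambda>r y. gamma_weight y *\<^sub>R (E r * p (r * sqrt y) - C * ?c y)" and f = "\<lambda>_. 0"])
    show "(\<lambda>y. gamma_weight y *\<^sub>R (E r * p (r * sqrt y) - C * ?c y)) \<in> borel_measurable lborel" for r
      by measurable
    show "integrable lborel (\<lambda>y. (1 + norm C) * gamma_weight y)"
      using integrable_gamma_weight by simp
    have b: "norm (E r * p (r * sqrt y) - C * ?c y) \<le> 1 + norm C" for r y
      using norm_triangle_ineq4[of "E r * p (r * sqrt y)" "C * ?c y"] le1[of "r * sqrt y"]
      by (simp add: norm_mult E_def)
    then show "\<forall>\<^sub>F r in at_top. AE y in lborel. norm (gamma_weight y *\<^sub>R (E r * p (r * sqrt y) - C * ?c y)) \<le> (1 + norm C) * gamma_weight y"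
      by (intro always_eventually allI AE_I2)
         (simp add: gamma_weight_nonneg mult.commute[of "1 + norm C"] mult_left_mono)
    show "AE y in lborel. ((\<lambda>r. gamma_weight y *\<^sub>R (E r * p (r * sqrt y) - C * ?c y)) \<longlongrightarrow> 0) at_top"
    proof (rule AE_I2)
      fix y :: real
      show "((\<lambda>r. gamma_weight y *\<^sub>R (E r * p (r * sqrt y) - C * ?c y)) \<longlongrightarrow> 0) at_top"
      proof (cases "y > 0")
        case True
        have *: "norm (E r * p (r * sqrt y) - C * ?c y) \<le> K / sqrt y / r" if "r > 0" for r
        proof -
          have "E r * cnj (E r) = 1" unfolding E_def cis_cnj cis_mult by simp
          then have "E r * p (r * sqrt y) - C * ?c y = E r * (p (r * sqrt y) - C * (cnj (E r) * ?c y))"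
            by (simp add: algebra_simps)
          also have "norm \<dots> = norm (p (r * sqrt y) - C * (cnj (E r) * ?c y))"
            unfolding norm_mult by (simp add: E_def)
          also have "\<dots> \<le> K / (r * sqrt y)"
            using C[of "r * sqrt y"] that True unfolding split[OF that True] by simp
          finally show ?thesis by (simp add: mult.commute)
        qed
        have "((\<lambda>r. K / sqrt y / r) \<longlongrightarrow> 0) at_top"
          by (intro tendsto_divide_0[OF tendsto_const] filterlim_at_top_imp_at_infinity filterlim_ident)
        moreover have "\<forall>\<^sub>F r in at_top. norm (E r * p (r * sqrt y) - C * ?c y) \<le> K / sqrt y / r"
          by (rule eventually_mono[OF eventually_gt_at_top[of 0]]) (rule *)
        ultimately have "((\<lambda>r. E r * p (r * sqrt y) - C * ?c y) \<longlongrightarrow> 0) at_top"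
          by (rule Lim_null_comparison[rotated])
        from tendsto_scaleR[OF tendsto_const this, of "gamma_weight y"] show ?thesis by simp
      qed (simp add: gamma_weight_def)
    qed
  qed simp
  moreover have "(\<integral>y. gamma_weight y *\<^sub>R (E r * p (r * sqrt y) - C * ?c y) \<partial>lborel)
      = E r * spinor_transform p r - C * ?G" for r
  proof -
    have i1: "integrable lborel (\<lambda>y. gamma_weight y *\<^sub>R p (r * sqrt y))"
      by (rule integrable_weighted[OF integrable_gamma_weight _ le1]) measurable
    have "(\<integral>y. gamma_weight y *\<^sub>R (E r * p (r * sqrt y) - C * ?c y) \<partial>lborel)
      = (\<integral>y. E r * (gamma_weight y *\<^sub>R p (r * sqrt y)) - C * (gamma_weight y *\<^sub>R ?c y) \<partial>lborel)"
      by (simp add: scaleR_conv_of_real algebra_simps)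
    also have "\<dots> = E r * spinor_transform p r - C * ?G"
      unfolding spinor_transform_def gamma_weight_integral(2)[symmetric] integral_mult_right_zero
        Bochner_Integration.integral_diff[OF integrable_mult_right[OF i1]
          integrable_mult_right[OF gamma_weight_integral(1)]] ..
    finally show ?thesis .
  qed
  ultimately have "((\<lambda>r. E r * spinor_transform p r - C * ?G) \<longlongrightarrow> 0) at_top" by simp
  then have "((\<lambda>r. E r * spinor_transform p r) \<longlongrightarrow> C * ?G) at_top" by (simp flip: Lim_null)
  from tendsto_norm[OF this] show ?thesis
    by (simp add: norm_mult E_def)
qed

text \<open>The two evaluations of the limit agree: \<open>\<bar>C\<bar>\<^sup>2 \<pi> / cosh x = \<pi> exp (- x)\<close> with
\<open>x = \<pi> a\<^sup>2/4\<close>.\<close>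

lemma spinor_amplitude:
  assumes sp: "spinor a p q" and "a > 0"
    and C: "\<And>s. s > 0 \<Longrightarrow> norm (p s - C * cis (- (a\<^sup>2 / 2 * ln s))) \<le> K / s"
  shows "2 * (norm C)\<^sup>2 = 1 + exp (- (pi * a\<^sup>2 / 2))"
proof -
  let ?G = "Gamma (1 / 2 - \<i> * complex_of_real (a\<^sup>2 / 4))" and ?x = "pi * (a\<^sup>2 / 4)"
  have "((\<lambda>r. (norm (spinor_transform p r))\<^sup>2) \<longlongrightarrow> (norm (C * ?G))\<^sup>2) at_top"
    by (intro tendsto_power spinor_transform_limit[OF sp C])
  moreover have "((\<lambda>r. (norm (spinor_transform p r))\<^sup>2) \<longlongrightarrow> pi * exp (- (a\<^sup>2 / 2 * (pi / 2)))) at_top"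
    unfolding spinor_transform_norm[OF sp \<open>a > 0\<close>]
  proof (intro tendsto_intros)
    have "filterlim (\<lambda>r::real. r\<^sup>2 * (1 / 4)) at_top at_top"
      by (intro filterlim_at_top_mult_tendsto_pos[OF tendsto_const] filterlim_pow_at_top filterlim_ident) auto
    then have "filterlim (\<lambda>r::real. r\<^sup>2 / 4) at_top at_top" by simp
    then show "((\<lambda>r. arctan (r\<^sup>2 / 4)) \<longlongrightarrow> pi / 2) at_top"
      by (rule filterlim_compose[OF tendsto_arctan_at_top])
  qed
  ultimately have "(norm (C * ?G))\<^sup>2 = pi * exp (- ?x)"
    using tendsto_unique[OF trivial_limit_at_top_linorder] by (simp add: mult.commute)
  then have "(norm C)\<^sup>2 * ((norm ?G)\<^sup>2 * cosh ?x) = pi * exp (- ?x) * cosh ?x"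
    by (simp only: norm_mult power_mult_distrib mult.assoc[symmetric])
  then have "pi * (norm C)\<^sup>2 = pi * (exp (- ?x) * cosh ?x)"
    unfolding norm_Gamma_half_minus by (simp only: mult_ac)
  then have "(norm C)\<^sup>2 = exp (- ?x) * cosh ?x"
    by (simp only: mult_cancel_left pi_neq_zero simp_thms)
  then have "2 * (norm C)\<^sup>2 = exp (- ?x) * exp ?x + exp (- ?x) * exp (- ?x)"
    by (simp add: cosh_def algebra_simps)
  also have "\<dots> = 1 + exp (- (pi * a\<^sup>2 / 2))"
    unfolding exp_add[symmetric] by simp
  finally show ?thesis .
qed

section \<open>Self-similar solutions and moving frames\<close>


lemma curve_deriv_eqI:
  "(\<And>s. (\<gamma> has_vector_derivative \<gamma>' s) (at s)) \<Longrightarrow> curve_deriv \<gamma> = \<gamma>'"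
  unfolding curve_deriv_def by (auto intro: vector_derivative_at)

text \<open>Combinations of the frame with polynomial coefficients are closed under differentiation and contain
the profile; this gives smoothness of all orders at once.\<close>

definition frame_combination ::
    "(real \<Rightarrow> real^3) \<Rightarrow> (real \<Rightarrow> real^3) \<Rightarrow> (real \<Rightarrow> real^3) \<Rightarrow> real poly \<Rightarrow> real poly \<Rightarrow> real poly \<Rightarrow> real \<Rightarrow> real^3"
  where "frame_combination T n b P Q S = (\<lambda>s. poly P s *\<^sub>R T s + poly Q s *\<^sub>R n s + poly S s *\<^sub>R b s)"

lemma frame_combination_derivative:
  assumes "frenet_eqs a T n b"
  shows "(frame_combination T n b P Q S has_vector_derivative
    frame_combination T n b (pderiv P - smult a Q) (pderiv Q + smult a P - [:0, 1/2:] * S)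
      (pderiv S + [:0, 1/2:] * Q) s) (at s)"
proof -
  note d = frenet_eqsD[OF assms]
  have p: "(poly P has_vector_derivative poly (pderiv P) s) (at s)" for P :: "real poly" and s
    using poly_DERIV by (simp flip: has_real_derivative_iff_has_vector_derivative)
  note m = bounded_bilinear.has_vector_derivative[OF bounded_bilinear_scaleR p]
  show ?thesis
    unfolding frame_combination_def
    by (rule has_vector_derivative_eq_rhs[OF has_vector_derivative_add[OF has_vector_derivative_add[OF
          m[OF d(1)] m[OF d(2)]] m[OF d(3)]]])
       (simp add: algebra_simps)
qed

lemma smooth_frame_combination:
  assumes "frenet_eqs a T n b"
  shows "smooth_curve (frame_combination T n b P Q S)"
proof -
  have "\<exists>P' Q' S'. (curve_deriv ^^ k) (frame_combination T n b P Q S) = frame_combination T n b P' Q' S'" for k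
  proof (induction k)
    case (Suc k)
    then obtain P' Q' S' where "(curve_deriv ^^ k) (frame_combination T n b P Q S) = frame_combination T n b P' Q' S'"
      by blast
    then show ?case
      using curve_deriv_eqI[OF frame_combination_derivative[OF assms, of P' Q' S']]
      by (simp only: funpow.simps o_apply) (intro exI, rule refl)
  qed auto
  then show ?thesis
    unfolding smooth_curve_def
    using frame_combination_derivative[OF assms] differentiableI_vector by metis
qed

lemma similarity_derivatives:
  fixes G :: "real \<Rightarrow> real^3"
  assumes "t > 0" "(G has_vector_derivative G') (at (s / sqrt t))"
  shows "((\<lambda>u. sqrt t *\<^sub>R G (u / sqrt t)) has_vector_derivative G') (at s)"
    and "((\<lambda>\<tau>. sqrt \<tau> *\<^sub>R G (s / sqrt \<tau>)) has_vector_derivative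
      (1 / sqrt t) *\<^sub>R ((1 / 2) *\<^sub>R G (s / sqrt t) - (s / sqrt t / 2) *\<^sub>R G')) (at t)"
proof -
  have "((\<lambda>u. u / sqrt t) has_vector_derivative 1 / sqrt t) (at s)"
    using assms(1) by (auto intro!: derivative_eq_intros simp: field_simps simp flip: has_real_derivative_iff_has_vector_derivative)
  from bounded_linear.has_vector_derivative[OF bounded_linear_scaleR_right vector_diff_chain_at[OF this assms(2)], of "sqrt t"]
  show "((\<lambda>u. sqrt t *\<^sub>R G (u / sqrt t)) has_vector_derivative G') (at s)"
    using assms(1) by (simp add: o_def)
  have 1: "((\<lambda>\<tau>. s / sqrt \<tau>) has_vector_derivative - (s / (2 * t * sqrt t))) (at t)"
    using assms(1) by (auto intro!: derivative_eq_intros simp: field_simps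
      simp flip: has_real_derivative_iff_has_vector_derivative)
  have 2: "(sqrt has_vector_derivative 1 / (2 * sqrt t)) (at t)"
    using assms(1) by (auto intro!: derivative_eq_intros simp: field_simps
      simp flip: has_real_derivative_iff_has_vector_derivative)
  show "((\<lambda>\<tau>. sqrt \<tau> *\<^sub>R G (s / sqrt \<tau>)) has_vector_derivative
      (1 / sqrt t) *\<^sub>R ((1 / 2) *\<^sub>R G (s / sqrt t) - (s / sqrt t / 2) *\<^sub>R G')) (at t)"
    by (rule has_vector_derivative_eq_rhs[OF bounded_bilinear.has_vector_derivative[OF bounded_bilinear_scaleR 2
          vector_diff_chain_at[OF 1 assms(2), unfolded o_def]]])
       (use assms(1) in \<open>simp add: algebra_simps\<close>)
qed

text \<open>For \<open>u = s / \<surd>t\<close> both sides of the flow equation equal \<open>(a / \<surd>t) b(u)\<close>.\<close>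

lemma self_similar_of_frame:
  assumes fr: "frenet_eqs a T n b" and "a > 0"
    and T: "\<And>s. norm (T s) = 1" and n: "\<And>s. norm (n s) = 1" and cr: "\<And>s. T s \<times> n s = b s"
    and X: "\<And>s t. t > 0 \<Longrightarrow> X s t = sqrt t *\<^sub>R G (s / sqrt t)"
    and G: "G = (\<lambda>s. s *\<^sub>R T s + (2 * a) *\<^sub>R b s)"
  shows "self_similar_solution X"
proof -
  have Gc: "G = frame_combination T n b [:0, 1:] 0 [:2 * a:]"
    by (simp add: frame_combination_def G)
  have dG: "(G has_vector_derivative T s) (at s)" for s
    unfolding Gc
    by (rule has_vector_derivative_eq_rhs[OF frame_combination_derivative[OF fr]])
       (simp add: frame_combination_def pderiv_pCons)
  then have G1: "curve_deriv G = T" by (rule curve_deriv_eqI)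
  have T1: "curve_deriv T = (\<lambda>s. a *\<^sub>R n s)" by (intro curve_deriv_eqI frenet_eqsD[OF fr])
  have "solves_binormal_flow X"
    unfolding solves_binormal_flow_def Let_def
  proof (intro allI impI)
    fix t s :: real assume t: "t > 0"
    have Xt: "(\<lambda>u. X u t) = (\<lambda>u. sqrt t *\<^sub>R G (u / sqrt t))" using X[OF t] by simp
    have d1: "((\<lambda>u. X u t) has_vector_derivative T (s / sqrt t)) (at s)" for s
      unfolding Xt by (rule similarity_derivatives(1)[OF t dG])
    then have c1: "curve_deriv (\<lambda>u. X u t) = (\<lambda>s. T (s / sqrt t))" by (rule curve_deriv_eqI)
    have "((\<lambda>u. u / sqrt t) has_vector_derivative 1 / sqrt t) (at s)" for s
      using t by (auto intro!: derivative_eq_intros simp: field_simps simp flip: has_real_derivative_iff_has_vector_derivative)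
    from vector_diff_chain_at[OF this frenet_eqsD(1)[OF fr]]
    have d2: "(curve_deriv (\<lambda>u. X u t) has_vector_derivative (1 / sqrt t) *\<^sub>R a *\<^sub>R n (s / sqrt t)) (at s)" for s
      unfolding c1 by (simp add: o_def)
    have c2: "curve_deriv (curve_deriv (\<lambda>u. X u t)) s = (1 / sqrt t) *\<^sub>R a *\<^sub>R n (s / sqrt t)"
      unfolding curve_deriv_eqI[OF d2] ..
    have "((\<lambda>\<tau>. sqrt \<tau> *\<^sub>R G (s / sqrt \<tau>)) has_vector_derivative
        T (s / sqrt t) \<times> ((1 / sqrt t) *\<^sub>R a *\<^sub>R n (s / sqrt t))) (at t)"
      by (rule has_vector_derivative_eq_rhs[OF similarity_derivatives(2)[OF t dG]])
         (simp add: G cross_mult_right cr algebra_simps)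
    then have d3: "((\<lambda>\<tau>. X s \<tau>) has_vector_derivative
        T (s / sqrt t) \<times> ((1 / sqrt t) *\<^sub>R a *\<^sub>R n (s / sqrt t))) (at t)"
      by (rule has_vector_derivative_transform_within_open[of _ _ _ "{0<..}"]) (use t X in auto)
    show "(\<lambda>u. X u t) differentiable at s \<and> norm (curve_deriv (\<lambda>u. X u t) s) = 1 \<and>
        curve_deriv (\<lambda>u. X u t) differentiable at s \<and>
        ((\<lambda>\<tau>. X s \<tau>) has_vector_derivative curve_deriv (\<lambda>u. X u t) s \<times> curve_deriv (curve_deriv (\<lambda>u. X u t)) s) (at t)"
      using d1 d2 d3 T unfolding c2 unfolding c1 by (auto intro: differentiableI_vector)
  qed
  moreover have "smooth_curve G" unfolding Gc by (rule smooth_frame_combination[OF fr])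
  moreover have "curvature G s \<noteq> 0" for s
    using n[of s] assms(2) by (simp add: curvature_def G1 T1)
  ultimately show ?thesis
    unfolding self_similar_solution_def using X T by (auto intro!: exI[of _ G] simp: G1)
qed

text \<open>The flow equation at \<open>t = 1\<close> reads \<open>B = G/2 - s T/2\<close> for \<open>B = T \<times> T'\<close>. Then \<open>B' = - s T'/2\<close> is
orthogonal to \<open>B\<close>, so \<open>\<bar>B\<bar> = \<bar>T'\<bar>\<close> is a constant \<open>a\<close>. Normalizing \<open>T'\<close> and \<open>B\<close> gives \<open>n\<close> and \<open>b\<close>;
the equation for \<open>n\<close> comes from \<open>n = b \<times> T\<close>.\<close>

lemma self_similar_imp_frame:
  assumes "self_similar_solution X"
  obtains a T n b G where "a > 0" "frenet_eqs a T n b" "\<And>s. norm (T s) = 1" "\<And>s. norm (n s) = 1"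
    "\<And>s. T s \<bullet> n s = 0" "\<And>s. T s \<times> n s = b s" "\<And>s. (G has_vector_derivative T s) (at s)"
    "G 0 = (2 * a) *\<^sub>R b 0" "\<And>s t. t > 0 \<Longrightarrow> X s t = sqrt t *\<^sub>R G (s / sqrt t)"
proof -
  obtain G where G: "smooth_curve G" "\<And>s. norm (curve_deriv G s) = 1" "\<And>s. curvature G s \<noteq> 0"
    and X: "\<And>s t. t > 0 \<Longrightarrow> X s t = sqrt t *\<^sub>R G (s / sqrt t)" and flow: "solves_binormal_flow X"
    using assms unfolding self_similar_solution_def by blast
  define T where "T = curve_deriv G"
  define T' where "T' = curve_deriv T"
  define B where "B = (\<lambda>s. T s \<times> T' s)"
  have diff: "((curve_deriv ^^ k) G has_vector_derivative (curve_deriv ^^ Suc k) G s) (at s)" for k s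
    using G(1) by (simp add: smooth_curve_def curve_deriv_def flip: vector_derivative_works)
  have dG: "(G has_vector_derivative T s) (at s)" and dT: "(T has_vector_derivative T' s) (at s)" for s
    using diff[of 0 s] diff[of 1 s] by (simp_all add: T_def T'_def)
  have T1: "T s \<bullet> T s = 1" for s
    using G(2)[of s] by (simp add: T_def norm_eq_sqrt_inner)
  have TT': "T s \<bullet> T' s = 0" for s
  proof -
    have "((\<lambda>s. T s \<bullet> T s) has_vector_derivative T s \<bullet> T' s + T' s \<bullet> T s) (at s)"
      by (rule bounded_bilinear.has_vector_derivative[OF bounded_bilinear_inner dT dT])
    moreover have "((\<lambda>s. T s \<bullet> T s) has_vector_derivative 0) (at s)"
      unfolding T1 by simp
    ultimately have "T s \<bullet> T' s + T' s \<bullet> T s = 0" by (rule vector_derivative_unique_at)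
    then show ?thesis by (simp add: inner_commute)
  qed
  have B: "B s = (1 / 2) *\<^sub>R G s - (s / 2) *\<^sub>R T s" for s
  proof -
    have X1: "(\<lambda>u. X u 1) = G" using X[of 1] by simp
    have "(X s has_vector_derivative B s) (at 1)"
      using flow[unfolded solves_binormal_flow_def Let_def, rule_format, of 1 s]
      unfolding X1 T_def[symmetric] T'_def[symmetric] B_def by simp
    moreover have "(X s has_vector_derivative (1 / 2) *\<^sub>R G s - (s / 2) *\<^sub>R T s) (at 1)"
      by (rule has_vector_derivative_transform_within_open[of _ _ _ "{0<..}"],
          rule has_vector_derivative_eq_rhs[OF similarity_derivatives(2)[of 1, OF _ dG]])
         (use X in auto)
    ultimately show ?thesis by (rule vector_derivative_unique_at)
  qed
  have dB: "(B has_vector_derivative - (s / 2) *\<^sub>R T' s) (at s)" for s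
  proof -
    have h: "((\<lambda>s. s / 2) has_vector_derivative 1 / 2) (at s)"
      by (auto intro!: derivative_eq_intros simp flip: has_real_derivative_iff_has_vector_derivative)
    have "((\<lambda>s. (1 / 2) *\<^sub>R G s - (s / 2) *\<^sub>R T s) has_vector_derivative - (s / 2) *\<^sub>R T' s) (at s)"
      by (rule has_vector_derivative_eq_rhs[OF has_vector_derivative_diff[OF
            bounded_linear.has_vector_derivative[OF bounded_linear_scaleR_right dG]
            bounded_bilinear.has_vector_derivative[OF bounded_bilinear_scaleR h dT]]])
         simp
    then show ?thesis using B by presburger
  qed
  have BB: "B s \<bullet> B s = T' s \<bullet> T' s" for s
    using norm_cross[of "T s" "T' s"] T1[of s] TT'[of s] by (simp add: B_def power2_norm_eq_inner)
  have "((\<lambda>s. B s \<bullet> B s) has_vector_derivative 0) (at s)" for s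
    by (rule has_vector_derivative_eq_rhs[OF bounded_bilinear.has_vector_derivative[OF bounded_bilinear_inner dB dB]])
       (simp add: B_def dot_cross_self)
  from zero_derivative_imp_constant[of "\<lambda>s. B s \<bullet> B s", OF this]
  have const: "B s \<bullet> B s = B 0 \<bullet> B 0" for s .
  define a where "a = norm (B 0)"
  have nB: "norm (B s) = a" and nT': "norm (T' s) = a" for s
    using const[of s] BB[of s] by (simp_all add: a_def norm_eq_sqrt_inner)
  have "curvature G 0 = a" by (simp add: curvature_def T_def[symmetric] T'_def[symmetric] nT')
  then have a: "a > 0" using G(3)[of 0] by (simp add: a_def)
  define n where "n = (\<lambda>s. (1 / a) *\<^sub>R T' s)"
  define b where "b = (\<lambda>s. (1 / a) *\<^sub>R B s)"
  have cr: "T s \<times> n s = b s" for s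
    by (simp add: n_def b_def B_def cross_mult_right)
  have cr2: "b s \<times> T s = n s" for s
    using Lagrange[of "T s" "T s" "T' s"] T1[of s] TT'[of s] cross_skew[of "B s" "T s"]
    by (simp add: n_def b_def cross_mult_left B_def)
  have dT2: "(T has_vector_derivative a *\<^sub>R n s) (at s)" for s
    using dT[of s] a by (simp add: n_def)
  have db: "(b has_vector_derivative - (s / 2) *\<^sub>R n s) (at s)" for s
    unfolding b_def
    by (rule has_vector_derivative_eq_rhs[OF bounded_linear.has_vector_derivative[OF
          bounded_linear_scaleR_right[of "1 / a"] dB[of s]]])
       (simp add: n_def)
  have dn: "(n has_vector_derivative - a *\<^sub>R T s + (s / 2) *\<^sub>R b s) (at s)" for s
  proof -
    have "((\<lambda>s. b s \<times> T s) has_vector_derivative b s \<times> (a *\<^sub>R n s) + (- (s / 2) *\<^sub>R n s) \<times> T s) (at s)"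
      by (rule cross_has_vector_derivative[OF db dT2])
    moreover have "n s \<times> T s = - b s" using cross_skew[of "n s" "T s"] cr by simp
    moreover have "b s \<times> n s = - T s"
    proof -
      have "n s \<bullet> n s = 1" "n s \<bullet> T s = 0"
        using TT'[of s] nT'[of s] a by (simp_all add: n_def inner_commute dot_square_norm power2_eq_square)
      then have "n s \<times> b s = T s"
        using Lagrange[of "n s" "T s" "n s"] by (simp add: cr[symmetric])
      then show ?thesis using cross_skew[of "b s" "n s"] by simp
    qed
    ultimately show ?thesis
      by (simp add: cr2 cross_mult_left cross_mult_right)
  qed
  show thesis
  proof (rule that[of a T n b G])
    show "frenet_eqs a T n b" unfolding frenet_eqs_def using dT2 dn db by blast
    show "G 0 = (2 * a) *\<^sub>R b 0" using B[of 0] a by (simp add: b_def)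
    show "norm (T s) = 1" "norm (n s) = 1" "T s \<bullet> n s = 0" for s
      using T1[of s] TT'[of s] nT'[of s] a by (simp_all add: n_def norm_eq_sqrt_inner[of "T s"])
  qed (use a dG X cr in auto)
qed

lemma norm_rotation:
  assumes "rotation_matrix (R :: real^3^3)"
  shows "norm (R *v x) = norm x"
proof -
  have "orthogonal_transformation ((*v) R)"
    unfolding orthogonal_transformation_matrix
    using assms by (simp add: rotation_matrix_def matrix_of_matrix_vector_mul)
  then show ?thesis by (rule orthogonal_transformation_norm)
qed

text \<open>Given a self-similar solution, the orthogonal matrix with rows \<open>T(0), n(0), b(0)\<close> moves its frame to
the standard initial frame and therefore its \<open>G\<close> to the profile.\<close>

lemma self_similar_iff:
  "self_similar_solution X \<longleftrightarrow>
     (\<exists>a>0. \<exists>R. rotation_matrix R \<and> (\<forall>s. \<forall>t>0. X s t = R *v chi a s t))"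
proof
  assume "\<exists>a>0. \<exists>R. rotation_matrix R \<and> (\<forall>s. \<forall>t>0. X s t = R *v chi a s t)"
  then obtain a R where a: "a > 0" and R: "rotation_matrix R" and X: "\<forall>s. \<forall>t>0. X s t = R *v chi a s t"
    by blast
  obtain T n b where fr: "frenet_frame a T n b" using frenet_frame_exists[OF a] .
  note o = frenet_frame_orthonormal[OF fr]
  show "self_similar_solution X"
  proof (rule self_similar_of_frame[of a "\<lambda>s. R *v T s" "\<lambda>s. R *v n s" "\<lambda>s. R *v b s" X "\<lambda>s. R *v profile a s"])
    show "frenet_eqs a (\<lambda>s. R *v T s) (\<lambda>s. R *v n s) (\<lambda>s. R *v b s)"
      by (rule frenet_eqs_linear_image[OF matrix_vector_mul_bounded_linear
            conjunct1[OF fr[unfolded frenet_frame_iff]]])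
    show "norm (R *v T s) = 1" "norm (R *v n s) = 1" for s
      unfolding norm_rotation[OF R] using o(1,2)[of s] by (simp_all add: norm_eq_sqrt_inner)
    show "(R *v T s) \<times> (R *v n s) = R *v b s" for s
      by (simp add: cross_rotation_matrix[OF R] frenet_frame_cross[OF fr])
    show "X s t = sqrt t *\<^sub>R (R *v profile a (s / sqrt t))" if "t > 0" for s t
      using X that by (simp add: chi_def matrix_vector_mult_scaleR)
    show "(\<lambda>s. R *v profile a s) = (\<lambda>s. s *\<^sub>R (R *v T s) + (2 * a) *\<^sub>R (R *v b s))"
      by (simp add: profile_eq_frame[OF fr] matrix_vector_right_distrib matrix_vector_mult_scaleR)
  qed fact
next
  assume "self_similar_solution X"
  then obtain a T n b G where a: "a > 0" and fr: "frenet_eqs a T n b" and T: "\<And>s. norm (T s) = 1"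
    and n: "\<And>s. norm (n s) = 1" and Tn: "\<And>s. T s \<bullet> n s = 0" and cr: "\<And>s. T s \<times> n s = b s"
    and dG: "\<And>s. (G has_vector_derivative T s) (at s)" and G0: "G 0 = (2 * a) *\<^sub>R b 0"
    and X: "\<And>s t. t > 0 \<Longrightarrow> X s t = sqrt t *\<^sub>R G (s / sqrt t)"
    by (rule self_similar_imp_frame) blast
  define F :: "real^3^3" where "F = vector [T 0, n 0, b 0]"
  have i: "T 0 \<bullet> T 0 = 1" "n 0 \<bullet> n 0 = 1" "T 0 \<bullet> n 0 = 0" "T 0 \<bullet> b 0 = 0" "n 0 \<bullet> b 0 = 0"
    "n 0 \<bullet> T 0 = 0" "b 0 \<bullet> T 0 = 0" "b 0 \<bullet> n 0 = 0"
    using T n Tn[of 0] by (simp_all add: norm_eq_sqrt_inner cr[symmetric] dot_cross_self inner_commute)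
  have b: "b 0 \<bullet> b 0 = 1"
    using norm_cross[of "T 0" "n 0"] i by (simp add: cr power2_norm_eq_inner)
  have orth: "orthogonal_matrix F"
    unfolding orthogonal_matrix_orthonormal_rows
    using T n b i by (auto simp: F_def row_def forall_3 norm_eq_sqrt_inner orthogonal_def inner_commute)
  have "det F = T 0 \<bullet> (n 0 \<times> b 0)"
    by (simp add: F_def dot_cross_det)
  also have "\<dots> = 1"
    using cross_triple[of "T 0" "n 0" "b 0"] b cr[of 0] by (simp add: inner_commute)
  finally have det: "det F = 1" .
  have F: "F *v v = vector [T 0 \<bullet> v, n 0 \<bullet> v, b 0 \<bullet> v]" for v
    by (simp add: vec_eq_iff forall_3 F_def matrix_vector_mul_component)
  have "profile a = (\<lambda>s. F *v G s)"
  proof (rule profile_eqI)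
    show "frenet_frame a (\<lambda>s. F *v T s) (\<lambda>s. F *v n s) (\<lambda>s. F *v b s)"
      unfolding frenet_frame_iff
      by (intro conjI frenet_eqs_linear_image[OF matrix_vector_mul_bounded_linear fr])
         (simp_all add: F i b)
    show "((\<lambda>s. F *v G s) has_vector_derivative F *v T s) (at s)" for s
      by (rule bounded_linear.has_vector_derivative[OF matrix_vector_mul_bounded_linear dG])
    show "F *v G 0 = (2 * a) *\<^sub>R vector [0, 0, 1]"
      unfolding G0 matrix_vector_mult_scaleR by (simp add: F i b)
  qed
  then have "transpose F *v profile a s = G s" for s
    using orth by (simp add: matrix_vector_mul_assoc orthogonal_matrix)
  then have "X s t = transpose F *v chi a s t" if "t > 0" for s t
    using X[OF that, of s] that by (simp add: chi_def matrix_vector_mult_scaleR)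
  moreover have "rotation_matrix (transpose F)"
    using orth det by (simp add: rotation_matrix_def orthogonal_matrix_transpose)
  ultimately show "\<exists>a>0. \<exists>R. rotation_matrix R \<and> (\<forall>s. \<forall>t>0. X s t = R *v chi a s t)"
    using a by blast
qed

text \<open>A rotation preserves the distance \<open>2 a\<close> of \<open>G\<^sub>a(0)\<close> from the origin.\<close>

lemma chi_rotation_unique:
  assumes "a > 0" "a' > 0" "rotation_matrix R" "\<And>s t. t > 0 \<Longrightarrow> chi a' s t = R *v chi a s t"
  shows "a = a'"
proof -
  have n: "norm (chi c 0 1) = 2 * c" if c: "c > 0" for c
  proof -
    obtain T n b where fr: "frenet_frame c T n b" using frenet_frame_exists[OF c] .
    have "(norm (profile c 0))\<^sup>2 = (2 * c)\<^sup>2"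
      using norm_profile[OF fr, of 0] by (simp add: power_mult_distrib)
    then have "norm (profile c 0) = 2 * c"
      by (rule power2_eq_imp_eq) (use c in simp_all)
    then show ?thesis by (simp add: chi_def)
  qed
  have "2 * a' = norm (R *v chi a 0 1)"
    unfolding assms(4)[OF zero_less_one, symmetric] by (rule n[OF assms(2), symmetric])
  also have "\<dots> = 2 * a"
    unfolding norm_rotation[OF assms(3)] by (rule n[OF assms(1)])
  finally show ?thesis by simp
qed

section \<open>The corner at time zero and the angle\<close>


text \<open>\<open>T\<^sub>1 = 2 \<bar>p\<bar>\<^sup>2 - 1\<close> tends to \<open>2 \<bar>C\<bar>\<^sup>2 - 1\<close>, where \<open>C\<close> is the amplitude of \<open>p\<close> at infinity.\<close>

lemma tangent_limit_first_component:
  assumes fr: "frenet_frame a T n b" and a: "a > 0"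
    and A: "\<And>s. s > 0 \<Longrightarrow> norm (T s - A) \<le> 4 * a / s"
  shows "A $ 1 = exp (- (pi * a\<^sup>2 / 2))"
proof -
  obtain p q where sp: "spinor a p q" using spinor_exists[OF a] .
  obtain C K where C: "\<And>s. s > 0 \<Longrightarrow> norm (p s - C * cis (- (a\<^sup>2 / 2 * ln s))) \<le> K / s"
    using spinor_asymptotics[OF sp a] by blast
  have null: "((\<lambda>s. c / s) \<longlongrightarrow> 0) at_top" for c :: real
    by (intro tendsto_divide_0[OF tendsto_const] filterlim_at_top_imp_at_infinity filterlim_ident)
  have "((\<lambda>s. T s - A) \<longlongrightarrow> 0) at_top"
    by (rule Lim_null_comparison[OF eventually_mono[OF eventually_gt_at_top[of 0] A] null])
  then have "(T \<longlongrightarrow> A) at_top" by (simp flip: Lim_null)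
  then have 1: "((\<lambda>s. T s $ 1) \<longlongrightarrow> A $ 1) at_top" by (rule tendsto_vec_nth)
  have "\<bar>norm (p s) - norm C\<bar> \<le> K / s" if "s > 0" for s
    using C[OF that] norm_triangle_ineq3[of "p s" "C * cis (- (a\<^sup>2 / 2 * ln s))"]
    by (simp add: norm_mult)
  then have "((\<lambda>s. norm (p s) - norm C) \<longlongrightarrow> 0) at_top"
    by (intro Lim_null_comparison[OF eventually_mono[OF eventually_gt_at_top[of 0]] null[of K]]) simp
  then have "((\<lambda>s. norm (p s)) \<longlongrightarrow> norm C) at_top" by (simp flip: Lim_null)
  then have "((\<lambda>s. 2 * (norm (p s))\<^sup>2 - 1) \<longlongrightarrow> 2 * (norm C)\<^sup>2 - 1) at_top"
    by (intro tendsto_diff tendsto_mult tendsto_power tendsto_const)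
  moreover have "T s $ 1 = 2 * (norm (p s))\<^sup>2 - 1" for s
    using spinor_tangent[OF sp fr, of s] spinor_norm[OF sp, of s] by simp
  ultimately have "A $ 1 = 2 * (norm C)\<^sup>2 - 1"
    using tendsto_unique[OF trivial_limit_at_top_linorder 1] by simp
  then show ?thesis using spinor_amplitude[OF sp a C] by simp
qed

lemma norm_half_turn: "norm (half_turn v) = norm v"
  by (simp add: norm_eq_sqrt_inner inner_vec_def sum_3 half_turn_def)

text \<open>The broken line that the flow reaches at time zero, parametrized by arclength.\<close>

definition corner :: "real^3 \<Rightarrow> real \<Rightarrow> real^3" where
  "corner A s = (if s \<ge> 0 then s *\<^sub>R A else s *\<^sub>R half_turn A)"

lemma profile_near_corner:
  assumes fr: "frenet_frame a T n b"
    and A: "\<And>s. s \<ge> 0 \<Longrightarrow> norm (profile a s - s *\<^sub>R A) \<le> 2 * a"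
  shows "norm (profile a s - corner A s) \<le> 2 * a"
proof (cases "s \<ge> 0")
  case False
  interpret L: bounded_linear half_turn by (rule bounded_linear_half_turn)
  have "profile a s - corner A s = - half_turn (profile a (- s) - (- s) *\<^sub>R A)"
    using False profile_reflect[OF fr, of "- s"] by (simp add: corner_def L.diff L.scaleR L.neg L.add)
  then have "norm (profile a s - corner A s) = norm (profile a (- s) - (- s) *\<^sub>R A)"
    by (simp only: norm_minus_cancel norm_half_turn)
  also have "\<dots> \<le> 2 * a" by (rule A) (use False in simp)
  finally show ?thesis .
qed (use A in \<open>simp add: corner_def\<close>)

lemma corner_scale: "r > 0 \<Longrightarrow> r *\<^sub>R corner A (s / r) = corner A s"
  by (auto simp: corner_def divide_simps)

text \<open>The corner is invariant under the parabolic scaling, so the estimate for the profile scales to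
all positive times.\<close>

lemma chi_near_corner:
  assumes "\<And>s. norm (profile a s - corner A s) \<le> 2 * a" "t > 0"
  shows "norm (chi a s t - corner A s) \<le> 2 * a * sqrt t"
proof -
  have "chi a s t - corner A s = sqrt t *\<^sub>R (profile a (s / sqrt t) - corner A (s / sqrt t))"
    using assms(2) corner_scale[of "sqrt t" A s] by (simp add: chi_def scaleR_right_diff_distrib)
  then have "norm (chi a s t - corner A s) = sqrt t * norm (profile a (s / sqrt t) - corner A (s / sqrt t))"
    using assms(2) by simp
  also have "\<dots> \<le> sqrt t * (2 * a)"
    using assms by (intro mult_left_mono) auto
  finally show ?thesis by (simp add: mult_ac)
qed

lemma chi_tendsto_corner:
  assumes "\<And>s. norm (profile a s - corner A s) \<le> 2 * a"
  shows "((\<lambda>t. chi a s t) \<longlongrightarrow> corner A s) (at_right 0)" and "chi a s 0 = corner A s"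
proof -
  have "((\<lambda>t. chi a s t - corner A s) \<longlongrightarrow> 0) (at_right 0)"
  proof (rule Lim_null_comparison)
    show "\<forall>\<^sub>F t in at_right 0. norm (chi a s t - corner A s) \<le> 2 * a * sqrt t"
      using eventually_at_right_less[of 0] by (rule eventually_mono) (rule chi_near_corner[OF assms])
    have "((\<lambda>t. 2 * a * sqrt t) \<longlongrightarrow> 2 * a * sqrt 0) (at_right 0)"
      by (intro tendsto_intros)
    then show "((\<lambda>t. 2 * a * sqrt t) \<longlongrightarrow> 0) (at_right 0)" by simp
  qed
  then show lim: "((\<lambda>t. chi a s t) \<longlongrightarrow> corner A s) (at_right 0)" by (simp flip: Lim_null)
  have "((\<lambda>t. sqrt t *\<^sub>R profile a (s / sqrt t)) \<longlongrightarrow> corner A s) (at_right 0)"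
    by (rule Lim_transform_eventually[OF lim])
       (use eventually_at_right_less[of 0] in \<open>rule eventually_mono, simp add: chi_def\<close>)
  from tendsto_Lim[OF _ this] show "chi a s 0 = corner A s"
    by (simp add: chi_def)
qed

text \<open>The cosine of the angle is \<open>A\<^sub>2\<^sup>2 + A\<^sub>3\<^sup>2 - A\<^sub>1\<^sup>2 = 1 - 2 A\<^sub>1\<^sup>2\<close>.\<close>

lemma sin_half_vec_angle:
  assumes "norm A = 1" "A $ 1 \<ge> 0"
  shows "sin (vec_angle A (- half_turn A) / 2) = A $ 1"
proof -
  let ?\<theta> = "vec_angle A (- half_turn A)"
  have s: "(A $ 1)\<^sup>2 + (A $ 2)\<^sup>2 + (A $ 3)\<^sup>2 = 1"
    using assms(1) by (simp add: norm_eq_sqrt_inner inner_vec_def sum_3 power2_eq_square)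
  have "A \<bullet> (- half_turn A) = 1 - 2 * (A $ 1)\<^sup>2"
    using s by (simp add: inner_vec_def sum_3 half_turn_def power2_eq_square)
  then have \<theta>: "?\<theta> = arccos (1 - 2 * (A $ 1)\<^sup>2)"
    by (simp add: vec_angle_def norm_half_turn assms(1))
  have "(A $ 1)\<^sup>2 \<le> 1" using s zero_le_power2[of "A $ 2"] zero_le_power2[of "A $ 3"] by linarith
  then have r: "-1 \<le> 1 - 2 * (A $ 1)\<^sup>2" "1 - 2 * (A $ 1)\<^sup>2 \<le> 1" by simp_all
  have "cos ?\<theta> = 1 - 2 * (A $ 1)\<^sup>2" unfolding \<theta> by (rule cos_arccos[OF r])
  moreover have "cos ?\<theta> = 1 - 2 * (sin (?\<theta> / 2))\<^sup>2"
    using cos_double_sin[of "?\<theta> / 2"] by simp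
  ultimately have "(sin (?\<theta> / 2))\<^sup>2 = (A $ 1)\<^sup>2" by simp
  moreover have "sin (?\<theta> / 2) \<ge> 0"
    unfolding \<theta> using arccos_lbound[OF r] arccos_ubound[OF r] by (intro sin_ge_zero) auto
  ultimately show ?thesis using assms(2) by (rule power2_eq_imp_eq)
qed

lemma corner_neq:
  assumes "norm A = 1" "0 < A $ 1" "A $ 1 < 1"
  shows "A \<noteq> half_turn A" "A \<noteq> - half_turn A"
proof -
  have s: "(A $ 1)\<^sup>2 + (A $ 2)\<^sup>2 + (A $ 3)\<^sup>2 = 1"
    using assms(1) by (simp add: norm_eq_sqrt_inner inner_vec_def sum_3 power2_eq_square)
  have "(A $ 1)\<^sup>2 \<noteq> 1" using assms(2,3) by (simp add: power2_eq_1_iff)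
  then have "A $ 2 \<noteq> 0 \<or> A $ 3 \<noteq> 0" using s by auto
  then show "A \<noteq> half_turn A" by (auto simp: half_turn_def vec_eq_iff forall_3)
  show "A \<noteq> - half_turn A" using assms(2) by (auto simp: half_turn_def vec_eq_iff forall_3)
qed

lemma profile_asymptotic_corner:
  assumes fr: "frenet_frame a T n b" and a: "a > 0"
  obtains A where "norm A = 1" "A $ 1 = exp (- (pi * a\<^sup>2 / 2))"
    "\<And>s. norm (profile a s - corner A s) \<le> 2 * a"
proof -
  obtain A where A: "norm A = 1" "\<And>s. s \<ge> 0 \<Longrightarrow> norm (profile a s - s *\<^sub>R A) \<le> 2 * a"
    "\<And>s. s > 0 \<Longrightarrow> norm (T s - A) \<le> 4 * a / s"
    using frenet_frame_asymptote[OF fr a] by blast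
  show thesis
    by (rule that[OF A(1) tangent_limit_first_component[OF fr a A(3)] profile_near_corner[OF fr A(2)]])
qed

text \<open>A zero \<open>s\<close> of \<open>G\<^sub>1\<close> satisfies \<open>\<bar>s\<bar> A\<^sub>1 \<le> 2 a\<close>.\<close>

lemma finite_self_intersections:
  assumes fr: "frenet_frame a T n b" and a: "a > 0"
  shows "finite (self_intersections (profile a))"
proof -
  obtain A where A: "A $ 1 = exp (- (pi * a\<^sup>2 / 2))" "\<And>s. norm (profile a s - corner A s) \<le> 2 * a"
    using profile_asymptotic_corner[OF fr a] by blast
  have pos: "A $ 1 > 0" by (simp add: A(1))
  have "finite {s. profile a s $ 1 = 0}"
  proof (rule finite_profile_zeros[OF fr a])
    fix s assume z: "profile a s $ 1 = 0"
    have "corner A s $ 1 = s * A $ 1" by (simp add: corner_def half_turn_def)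
    then have "\<bar>s * A $ 1\<bar> = \<bar>(profile a s - corner A s) $ 1\<bar>" using z by simp
    also have "\<dots> \<le> 2 * a" by (rule order_trans[OF component_le_norm_cart A(2)])
    finally show "\<bar>s\<bar> \<le> 2 * a / A $ 1"
      using pos by (simp add: abs_mult field_simps)
  qed
  then show ?thesis unfolding self_intersections_profile[OF fr] by simp
qed

lemma chi_time_one: "(\<lambda>s. chi a s 1) = profile a"
  by (simp add: chi_def fun_eq_iff)

theorem theorem4:
  shows "(\<forall>X. self_similar_solution X \<longleftrightarrow>
            (\<exists>a>0. \<exists>R. rotation_matrix R \<and> (\<forall>s. \<forall>t>0. X s t = R *v chi a s t)))
     \<and> (\<forall>a>0. \<forall>a'>0. \<forall>R. rotation_matrix R \<and> (\<forall>s. \<forall>t>0. chi a' s t = R *v chi a s t)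
            \<longrightarrow> a = a')
     \<and> (\<forall>a>0. (\<forall>s. ((\<lambda>t. chi a s t) \<longlongrightarrow> chi a s 0) (at_right 0)) \<and>
          (\<exists>Ap Am :: real^3.
             norm Ap = 1 \<and> norm Am = 1 \<and> Ap \<noteq> Am \<and> Ap \<noteq> - Am \<and>
             (\<forall>s. \<forall>t\<ge>0.
                norm (chi a s t - (s * indicator {0..} s) *\<^sub>R Ap - (s * indicator {..0} s) *\<^sub>R Am)
                  \<le> 2 * a * sqrt t) \<and>
             (\<forall>s>0. chi a s 0 = s *\<^sub>R Ap) \<and>
             (\<forall>s<0. chi a s 0 = s *\<^sub>R Am) \<and>
             sin (vec_angle Ap (- Am) / 2) = exp (- (pi * a\<^sup>2 / 2))))
     \<and> (\<exists>a1>0. \<forall>a. 0 < a \<and> a < a1 \<longrightarrow> self_intersections (\<lambda>s. chi a s 1) = {})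
     \<and> (\<exists>a2>0. \<forall>a>a2. self_intersections (\<lambda>s. chi a s 1) \<noteq> {} \<and>
                        finite (self_intersections (\<lambda>s. chi a s 1)))"
proof (intro conjI)
  show "\<forall>X. self_similar_solution X \<longleftrightarrow>
            (\<exists>a>0. \<exists>R. rotation_matrix R \<and> (\<forall>s. \<forall>t>0. X s t = R *v chi a s t))"
    by (intro allI self_similar_iff)
  show "\<forall>a>0. \<forall>a'>0. \<forall>R. rotation_matrix R \<and> (\<forall>s. \<forall>t>0. chi a' s t = R *v chi a s t)
            \<longrightarrow> a = a'"
    using chi_rotation_unique by blast
  show "\<forall>a>0. (\<forall>s. ((\<lambda>t. chi a s t) \<longlongrightarrow> chi a s 0) (at_right 0)) \<and>
          (\<exists>Ap Am :: real^3.
             norm Ap = 1 \<and> norm Am = 1 \<and> Ap \<noteq> Am \<and> Ap \<noteq> - Am \<and>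
             (\<forall>s. \<forall>t\<ge>0.
                norm (chi a s t - (s * indicator {0..} s) *\<^sub>R Ap - (s * indicator {..0} s) *\<^sub>R Am)
                  \<le> 2 * a * sqrt t) \<and>
             (\<forall>s>0. chi a s 0 = s *\<^sub>R Ap) \<and>
             (\<forall>s<0. chi a s 0 = s *\<^sub>R Am) \<and>
             sin (vec_angle Ap (- Am) / 2) = exp (- (pi * a\<^sup>2 / 2)))"
  proof (intro allI impI)
    fix a :: real assume a: "a > 0"
    obtain T n b where fr: "frenet_frame a T n b" using frenet_frame_exists[OF a] .
    obtain A where A: "norm A = 1" "A $ 1 = exp (- (pi * a\<^sup>2 / 2))"
      and near: "\<And>s. norm (profile a s - corner A s) \<le> 2 * a"
      using profile_asymptotic_corner[OF fr a] by blast
    have A1: "0 < A $ 1" "A $ 1 < 1" using a by (simp_all add: A(2))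
    note lim = chi_tendsto_corner[OF near]
    have split: "(s * indicator {0..} s) *\<^sub>R A + (s * indicator {..0} s) *\<^sub>R half_turn A = corner A s"
      for s by (auto simp: corner_def)
    have "norm (chi a s t - (s * indicator {0..} s) *\<^sub>R A - (s * indicator {..0} s) *\<^sub>R half_turn A)
        \<le> 2 * a * sqrt t" if "t \<ge> 0" for s t
      unfolding diff_diff_eq split
      using chi_near_corner[OF near] lim(2) that by (cases "t = 0") auto
    moreover have "chi a s 0 = s *\<^sub>R A" if "s > 0" for s using lim(2) that by (simp add: corner_def)
    moreover have "chi a s 0 = s *\<^sub>R half_turn A" if "s < 0" for s using lim(2) that by (simp add: corner_def)
    moreover have "sin (vec_angle A (- half_turn A) / 2) = exp (- (pi * a\<^sup>2 / 2))"
      using sin_half_vec_angle[OF A(1)] A1 A(2) by simp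
    moreover have "((\<lambda>t. chi a s t) \<longlongrightarrow> chi a s 0) (at_right 0)" for s
      using lim by simp
    ultimately show "(\<forall>s. ((\<lambda>t. chi a s t) \<longlongrightarrow> chi a s 0) (at_right 0)) \<and>
          (\<exists>Ap Am :: real^3.
             norm Ap = 1 \<and> norm Am = 1 \<and> Ap \<noteq> Am \<and> Ap \<noteq> - Am \<and>
             (\<forall>s. \<forall>t\<ge>0.
                norm (chi a s t - (s * indicator {0..} s) *\<^sub>R Ap - (s * indicator {..0} s) *\<^sub>R Am)
                  \<le> 2 * a * sqrt t) \<and>
             (\<forall>s>0. chi a s 0 = s *\<^sub>R Ap) \<and>
             (\<forall>s<0. chi a s 0 = s *\<^sub>R Am) \<and>
             sin (vec_angle Ap (- Am) / 2) = exp (- (pi * a\<^sup>2 / 2)))"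
      using A(1) norm_half_turn[of A] corner_neq[OF A(1) A1]
      by (intro conjI allI exI[of _ A] exI[of _ "half_turn A"] impI) auto
  qed
  show "\<exists>a1>0. \<forall>a. 0 < a \<and> a < a1 \<longrightarrow> self_intersections (\<lambda>s. chi a s 1) = {}"
  proof (intro exI[of _ "1 / 3"] conjI allI impI)
    fix a :: real assume a: "0 < a \<and> a < 1 / 3"
    then obtain T n b where "frenet_frame a T n b" using frenet_frame_exists by blast
    then show "self_intersections (\<lambda>s. chi a s 1) = {}"
      unfolding chi_time_one using a by (intro no_self_intersection_small) auto
  qed simp
  show "\<exists>a2>0. \<forall>a>a2. self_intersections (\<lambda>s. chi a s 1) \<noteq> {} \<and>
                        finite (self_intersections (\<lambda>s. chi a s 1))"
  proof (intro exI[of _ 6] conjI allI impI)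
    fix a :: real assume a: "a > 6"
    obtain T n b where fr: "frenet_frame a T n b" using frenet_frame_exists[of a] a by auto
    show "self_intersections (\<lambda>s. chi a s 1) \<noteq> {}"
      unfolding chi_time_one by (rule self_intersection_large[OF fr a])
    show "finite (self_intersections (\<lambda>s. chi a s 1))"
      unfolding chi_time_one by (rule finite_self_intersections[OF fr]) (use a in simp)
  qed simp
qed

end
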